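(* Let $(X,\mu)$ be a connected $d$-partite complex with sites $V$ and $W$ an absorbing random walk matrix on $V\cup B$, with polynomials $p_\sigma$ and cones $\mathcal{C}_\sigma$ defined below. Suppose that for every $\sigma\in X(d-2)$ we have $\lambda_2(P_\sigma)\leq\sqrt{W(u,v)\cdot W(v,u)}$, where $u,v$ are the two distinct sites of $V\setminus V(\sigma)$. Then $p_\sigma$ is $\mathcal{C}_\sigma$-Lorentzian for all $\sigma\in X$.
   Context: A $d$-partite complex $(X,\mu)$: a set $V$ of $d$ sites; each site $v$ has a finite nonempty set $S_v$ of spins (pairwise disjoint; elements written $vs_v$); $X$ is a pure simplicial complex on $\bigcup_vS_v$ whose facets contain exactly one spin from each $S_v$; $\mu$ a probability distribution on facets with every facet having positive probability. For a face $\sigma$: $V(\sigma)$ is the set of sites with a spin in $\sigma$; $\operatorname{codim}(\sigma)=d-|\sigma|$; $X(k)$ the faces of size $k$; the link $X_\sigma=\{\rho\setminus\sigma:\rho\supseteq\sigma\}$, $X_\sigma(k)$ its faces of size $k$. For $\operatorname{codim}(\sigma)\ge2$, $G_\sigma$ is the weighted graph on $X_\sigma(1)$ with edges $X_\sigma(2)$, weights $w_\sigma(x,y)=\sum_{\text{facets }\omega\supseteq\sigma\cup\{x,y\}}\mu(\omega)$; $P_\sigma$ its simple random walk matrix; $\lambda_2$ its second largest eigenvalue. $X$ is connected if every such $G_\sigma$ is connected. Absorbing random walk: $B$ a finite set disjoint from $V$, $W\in\mathbb{R}^{(V\cup B)\times(V\cup B)}$ a stochastic matrix such that from every $v\in V$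 there is a path $v=x_0,\dots,x_k\in B$ with $W(x_{i-1},x_i)>0$; for $U\subseteq V$ and $u,v\in V\cup B$, $\mathbb{W}_U[u\to v]=\sum\prod_{i=1}^\ell W(x_{i-1},x_i)$ over walks $(x_0,\dots,x_\ell)$, $\ell\ge0$, $x_0=u$, $x_\ell=v$, $x_1,\dots,x_{\ell-1}\notin B\cup U$. Maps: $\pi_{\sigma+us_u}:\mathbb{R}^{X_\sigma(1)}\to\mathbb{R}^{X_{\sigma\cup\{us_u\}}(1)}$, $\pi_{\sigma+us_u}(\mathbf{t})_{vs_v}=t_{vs_v}-\mathbb{W}_{V(\sigma)\cup\{u\}}[v\to u]\,t_{us_u}$; for $\tau\in X_\sigma$ with an ordering $x_1,\dots,x_k$, $\pi_{\sigma+\tau}=\pi_{(\sigma\cup\{x_1,\dots,x_{k-1}\})+x_k}\circ\cdots\circ\pi_{\sigma+x_1}$. Cone: $\mathcal{C}_\sigma$ is the set of $\mathbf{v}\in\mathbb{R}^{X_\sigma(1)}$ with positive entries such that $\pi_{\sigma+\tau}(\mathbf{v})$ has positive entries for all $\tau\in X_\sigma$ and all orderings of $\tau$. Polynomials: $p_\sigma$ on $\mathbb{R}^{X_\sigma(1)}$, defined recursively: $p_\sigma=\mu(\sigma)$ (a constant) if $\sigma$ is a facet, and otherwise $(d-|\sigma|)\,p_\sigma(\mathbf{t})=\sum_{x\in X_\sigma(1)}t_x\,p_{\sigma\cup\{x\}}(\pi_{\sigma+x}(\mathbf{t}))$; $p_\sigma$ is homogeneous of degree $d-|\sigma|$. $\mathcal{C}$-Lorentzian: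 for a non-empty open convex cone $\mathcal{C}\subseteq\mathbb{R}^n$, a $k$-homogeneous polynomial $p$ with $k\ge2$ is $\mathcal{C}$-Lorentzian if (P) $\nabla_{\mathbf{v}_1}\cdots\nabla_{\mathbf{v}_k}p>0$ for all $\mathbf{v}_1,\dots,\mathbf{v}_k\in\mathcal{C}$ and (Q) the Hessian of $\nabla_{\mathbf{v}_1}\cdots\nabla_{\mathbf{v}_{k-2}}p$ has at most one positive eigenvalue for all $\mathbf{v}_1,\dots,\mathbf{v}_{k-2}\in\mathcal{C}$ ($\nabla_{\mathbf{v}}$ is the directional derivative). A linear form satisfying (P) is $\mathcal{C}$-Lorentzian of degree $1$, and a positive constant is $\mathcal{C}$-Lorentzian of degree $0$. *)

theory Defs
  imports
    "HOL-Analysis.Analysis"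
    "HOL-Library.Countable_Set"
    "HOL-Library.Multiset"
    "Jordan_Normal_Form.Char_Poly"
begin

no_notation vec_index (infixl "$" 100)

section \<open>Partite complexes\<close>

definition facets :: "'x set set \<Rightarrow> 'x set set" where
  "facets X = {\<omega> \<in> X. \<forall>\<rho>\<in>X. \<omega> \<subseteq> \<rho> \<longrightarrow> \<rho> = \<omega>}"

text \<open>
  Purity (all facets have size \<open>d\<close>) is implied by the condition that a facet contains exactly one
  spin of each site. A spin is not required to be a vertex of \<open>X\<close>.
\<close>

definition partite_complex ::
  "nat \<Rightarrow> 'v set \<Rightarrow> ('v \<Rightarrow> 'x set) \<Rightarrow> 'x set set \<Rightarrow> ('x set \<Rightarrow> real) \<Rightarrow> bool" where
  "partite_complex d V S X \<mu> \<longleftrightarrow>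
     finite V \<and> card V = d \<and>
     (\<forall>v\<in>V. finite (S v) \<and> S v \<noteq> {}) \<and> disjoint_family_on S V \<and>
     X \<noteq> {} \<and> (\<forall>\<sigma>\<in>X. \<sigma> \<subseteq> (\<Union>v\<in>V. S v)) \<and> (\<forall>\<sigma>\<in>X. \<forall>\<tau>. \<tau> \<subseteq> \<sigma> \<longrightarrow> \<tau> \<in> X) \<and>
     (\<forall>\<omega>\<in>facets X. \<forall>v\<in>V. \<exists>!x. x \<in> \<omega> \<inter> S v) \<and>
     (\<forall>\<omega>\<in>facets X. \<mu> \<omega> > 0) \<and> (\<Sum>\<omega>\<in>facets X. \<mu> \<omega>) = 1"

definition site :: "'v set \<Rightarrow> ('v \<Rightarrow> 'x set) \<Rightarrow> 'x \<Rightarrow> 'v" where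
  "site V S x = (THE v. v \<in> V \<and> x \<in> S v)"

definition sites :: "'v set \<Rightarrow> ('v \<Rightarrow> 'x set) \<Rightarrow> 'x set \<Rightarrow> 'v set" where
  "sites V S \<sigma> = {v \<in> V. S v \<inter> \<sigma> \<noteq> {}}"

definition link :: "'x set set \<Rightarrow> 'x set \<Rightarrow> 'x set set" where
  "link X \<sigma> = {\<rho> - \<sigma> | \<rho>. \<rho> \<in> X \<and> \<sigma> \<subseteq> \<rho>}"

text \<open>The set \<open>X\<^sub>\<sigma>(1)\<close>, with a singleton face identified with its element.\<close>

definition link_vertices :: "'x set set \<Rightarrow> 'x set \<Rightarrow> 'x set" where
  "link_vertices X \<sigma> = {x. {x} \<in> link X \<sigma>}"

definition link_edges :: "'x set set \<Rightarrow> 'x set \<Rightarrow> 'x set set" where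
  "link_edges X \<sigma> = {e \<in> link X \<sigma>. card e = 2}"


section \<open>Spectra and local random walks\<close>

text \<open>
  A matrix indexed by a finite set \<open>A\<close> is a function \<open>M\<close> of two arguments from \<open>A\<close>; its
  eigenvalues are the real roots of the characteristic polynomial, with multiplicity. The spectrum
  does not depend on the enumeration \<^const>\<open>from_nat_into\<close> of \<open>A\<close>. Below this is only used for
  matrices that are symmetric, or are similar to a symmetric one because they are the transition
  matrix of a reversible walk; these have real spectrum.
\<close>

definition spectrum_on :: "'x set \<Rightarrow> ('x \<Rightarrow> 'x \<Rightarrow> real) \<Rightarrow> real multiset" where
  "spectrum_on A M =
     proots (char_poly (Matrix.mat (card A) (card A)
       (\<lambda>(i, j). M (from_nat_into A i) (from_nat_into A j))))"

definition lambda2 :: "'x set \<Rightarrow> ('x \<Rightarrow> 'x \<Rightarrow> real) \<Rightarrow> real" where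
  "lambda2 A M = rev (sorted_list_of_multiset (spectrum_on A M)) ! 1"

definition link_weight ::
  "'x set set \<Rightarrow> ('x set \<Rightarrow> real) \<Rightarrow> 'x set \<Rightarrow> 'x \<Rightarrow> 'x \<Rightarrow> real" where
  "link_weight X \<mu> \<sigma> x y =
     (if {x, y} \<in> link_edges X \<sigma>
      then \<Sum>\<omega> | \<omega> \<in> facets X \<and> \<sigma> \<union> {x, y} \<subseteq> \<omega>. \<mu> \<omega> else 0)"

definition walk_matrix ::
  "'x set set \<Rightarrow> ('x set \<Rightarrow> real) \<Rightarrow> 'x set \<Rightarrow> 'x \<Rightarrow> 'x \<Rightarrow> real" where
  "walk_matrix X \<mu> \<sigma> x y =
     link_weight X \<mu> \<sigma> x y / (\<Sum>z\<in>link_vertices X \<sigma>. link_weight X \<mu> \<sigma> x z)"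

definition connected_complex :: "nat \<Rightarrow> 'x set set \<Rightarrow> bool" where
  "connected_complex d X \<longleftrightarrow>
     (\<forall>\<sigma>\<in>X. card \<sigma> + 2 \<le> d \<longrightarrow>
        (\<forall>x\<in>link_vertices X \<sigma>. \<forall>y\<in>link_vertices X \<sigma>.
           (x, y) \<in> {(a, b). {a, b} \<in> link_edges X \<sigma>}\<^sup>*))"


section \<open>Absorbing random walks\<close>

definition absorbing_walk :: "'v set \<Rightarrow> 'v set \<Rightarrow> ('v \<Rightarrow> 'v \<Rightarrow> real) \<Rightarrow> bool" where
  "absorbing_walk V B W \<longleftrightarrow>
     finite V \<and> finite B \<and> V \<inter> B = {} \<and>
     (\<forall>u\<in>V \<union> B. \<forall>v\<in>V \<union> B. W u v \<ge> 0) \<and>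
     (\<forall>u\<in>V \<union> B. (\<Sum>v\<in>V \<union> B. W u v) = 1) \<and>
     (\<forall>v\<in>V. \<exists>b\<in>B. (v, b) \<in> {(x, y). x \<in> V \<union> B \<and> y \<in> V \<union> B \<and> W x y > 0}\<^sup>*)"

definition walks :: "'v set \<Rightarrow> 'v set \<Rightarrow> 'v set \<Rightarrow> 'v \<Rightarrow> 'v \<Rightarrow> 'v list set" where
  "walks V B U u v =
     {xs. xs \<noteq> [] \<and> set xs \<subseteq> V \<union> B \<and> hd xs = u \<and> last xs = v \<and>
          (\<forall>i. 0 < i \<and> i < length xs - 1 \<longrightarrow> xs ! i \<notin> B \<union> U)}"

definition walk_sum ::
  "'v set \<Rightarrow> 'v set \<Rightarrow> ('v \<Rightarrow> 'v \<Rightarrow> real) \<Rightarrow> 'v set \<Rightarrow> 'v \<Rightarrow> 'v \<Rightarrow> real" where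
  "walk_sum V B W U u v =
     (\<Sum>\<^sub>\<infinity>xs\<in>walks V B U u v. \<Prod>i<length xs - 1. W (xs ! i) (xs ! Suc i))"


section \<open>The maps, cones and polynomials of the complex\<close>

text \<open>
  For a set \<open>A\<close> of vertices, \<open>\<real>\<^sup>A\<close> is the subspace of vectors supported on \<open>A\<close> of the Euclidean space
  whose coordinates are indexed by the whole (finite) type of spins.
\<close>

definition coord_space :: "'x set \<Rightarrow> (real ^ 'x::finite) set" where
  "coord_space A = {t. \<forall>x. x \<notin> A \<longrightarrow> t $ x = 0}"

definition proj ::
  "'v set \<Rightarrow> ('v \<Rightarrow> 'x set) \<Rightarrow> 'x set set \<Rightarrow> 'v set \<Rightarrow> ('v \<Rightarrow> 'v \<Rightarrow> real) \<Rightarrow>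
   'x set \<Rightarrow> 'x \<Rightarrow> real ^ 'x::finite \<Rightarrow> real ^ 'x" where
  "proj V S X B W \<sigma> x t =
     (\<chi> y. if y \<in> link_vertices X (insert x \<sigma>)
           then t $ y
                - walk_sum V B W (sites V S \<sigma> \<union> {site V S x}) (site V S y) (site V S x) * t $ x
           else 0)"

primrec proj_list ::
  "'v set \<Rightarrow> ('v \<Rightarrow> 'x set) \<Rightarrow> 'x set set \<Rightarrow> 'v set \<Rightarrow> ('v \<Rightarrow> 'v \<Rightarrow> real) \<Rightarrow>
   'x set \<Rightarrow> 'x list \<Rightarrow> real ^ 'x::finite \<Rightarrow> real ^ 'x" where
  "proj_list V S X B W \<sigma> [] t = t"
| "proj_list V S X B W \<sigma> (x # xs) t =
     proj_list V S X B W (insert x \<sigma>) xs (proj V S X B W \<sigma> x t)"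

definition link_cone ::
  "'v set \<Rightarrow> ('v \<Rightarrow> 'x set) \<Rightarrow> 'x set set \<Rightarrow> 'v set \<Rightarrow> ('v \<Rightarrow> 'v \<Rightarrow> real) \<Rightarrow>
   'x set \<Rightarrow> (real ^ 'x::finite) set" where
  "link_cone V S X B W \<sigma> =
     {t \<in> coord_space (link_vertices X \<sigma>).
        (\<forall>x\<in>link_vertices X \<sigma>. t $ x > 0) \<and>
        (\<forall>xs. distinct xs \<and> set xs \<in> link X \<sigma> \<longrightarrow>
           (\<forall>y\<in>link_vertices X (\<sigma> \<union> set xs). proj_list V S X B W \<sigma> xs t $ y > 0))}"

text \<open>The recursion runs on the codimension, which is the first explicit argument.\<close>

primrec link_poly_codim ::
  "nat \<Rightarrow> 'v set \<Rightarrow> ('v \<Rightarrow> 'x set) \<Rightarrow> 'x set set \<Rightarrow> ('x set \<Rightarrow> real) \<Rightarrow>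
   'v set \<Rightarrow> ('v \<Rightarrow> 'v \<Rightarrow> real) \<Rightarrow> 'x set \<Rightarrow> real ^ 'x::finite \<Rightarrow> real" where
  "link_poly_codim 0 V S X \<mu> B W \<sigma> t = \<mu> \<sigma>"
| "link_poly_codim (Suc n) V S X \<mu> B W \<sigma> t =
     (\<Sum>x\<in>link_vertices X \<sigma>.
        t $ x * link_poly_codim n V S X \<mu> B W (insert x \<sigma>) (proj V S X B W \<sigma> x t)) / real (Suc n)"

definition link_poly ::
  "nat \<Rightarrow> 'v set \<Rightarrow> ('v \<Rightarrow> 'x set) \<Rightarrow> 'x set set \<Rightarrow> ('x set \<Rightarrow> real) \<Rightarrow>
   'v set \<Rightarrow> ('v \<Rightarrow> 'v \<Rightarrow> real) \<Rightarrow> 'x set \<Rightarrow> real ^ 'x::finite \<Rightarrow> real" where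
  "link_poly d V S X \<mu> B W \<sigma> = link_poly_codim (d - card \<sigma>) V S X \<mu> B W \<sigma>"

lemma card_facet:
  assumes "partite_complex d V S X \<mu>" "\<omega> \<in> facets X"
  shows "card \<omega> = d"
proof -
  have all: "\<forall>\<sigma>\<in>X. \<sigma> \<subseteq> (\<Union>v\<in>V. S v)" "\<forall>\<omega>\<in>facets X. \<forall>v\<in>V. \<exists>!x. x \<in> \<omega> \<inter> S v"
    and disj: "disjoint_family_on S V" and d: "card V = d"
    using assms(1) unfolding partite_complex_def by simp_all
  have "\<omega> \<in> X" using assms(2) by (simp add: facets_def)
  then have sub: "\<omega> \<subseteq> (\<Union>v\<in>V. S v)" using all(1) by simp
  have ex1: "\<exists>!x. x \<in> \<omega> \<inter> S v" if "v \<in> V" for v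
    using all(2) assms(2) that by simp
  define f where "f v = (THE x. x \<in> \<omega> \<inter> S v)" for v
  have f: "f v \<in> \<omega> \<inter> S v" if "v \<in> V" for v
    unfolding f_def using theI'[OF ex1[OF that]] .
  have f_eq: "f v = x" if "v \<in> V" "x \<in> \<omega>" "x \<in> S v" for v x
    unfolding f_def using the1_equality[OF ex1[OF that(1)]] that by simp
  have inj: "inj_on f V"
  proof (rule inj_onI, rule ccontr)
    fix u v assume uv: "u \<in> V" "v \<in> V" "f u = f v" "u \<noteq> v"
    have "S u \<inter> S v = {}"
      using disjoint_family_onD[OF disj uv(1,2,4)] .
    then show False using f[OF uv(1)] f[OF uv(2)] uv(3) by auto
  qed
  have "f ` V = \<omega>"
  proof (intro equalityI subsetI)
    fix x assume "x \<in> f ` V"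
    then show "x \<in> \<omega>" using f by auto
  next
    fix x assume x: "x \<in> \<omega>"
    then obtain v where "v \<in> V" "x \<in> S v" using sub by auto
    then show "x \<in> f ` V" using f_eq[OF _ x] by (metis imageI)
  qed
  then show ?thesis
    using card_image[OF inj] d by simp
qed

lemma card_nonfacet:
  fixes X :: "'x::finite set set"
  assumes "partite_complex d V S X \<mu>" "\<sigma> \<in> X" "\<sigma> \<notin> facets X"
  shows "card \<sigma> < d"
proof -
  have "finite X" by simp
  then obtain \<omega> where \<omega>: "\<omega> \<in> X" "\<sigma> \<subseteq> \<omega>" "\<forall>\<rho>\<in>X. \<omega> \<subseteq> \<rho> \<longrightarrow> \<omega> = \<rho>"
    using finite_has_maximal2[of X \<sigma>] assms(2) by blast
  then have fac: "\<omega> \<in> facets X" unfolding facets_def by auto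
  then have "\<sigma> \<subset> \<omega>" using \<omega>(2) assms(3) by auto
  then have "card \<sigma> < card \<omega>" by (simp add: psubset_card_mono)
  then show ?thesis using card_facet[OF assms(1) fac] by simp
qed

lemma link_poly_facet:
  assumes "partite_complex d V S X \<mu>" "\<sigma> \<in> facets X"
  shows "link_poly d V S X \<mu> B W \<sigma> t = \<mu> \<sigma>"
  using card_facet[OF assms] by (simp add: link_poly_def)

lemma link_poly_rec:
  assumes "partite_complex d V S X \<mu>" "\<sigma> \<in> X" "\<sigma> \<notin> facets X"
  shows "real (d - card \<sigma>) * link_poly d V S X \<mu> B W \<sigma> t =
    (\<Sum>x\<in>link_vertices X \<sigma>. t $ x * link_poly d V S X \<mu> B W (insert x \<sigma>) (proj V S X B W \<sigma> x t))"
proof -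
  obtain n where n: "d - card \<sigma> = Suc n"
    using card_nonfacet[OF assms] by (cases "d - card \<sigma>") simp_all
  have "d - card (insert x \<sigma>) = n" if "x \<in> link_vertices X \<sigma>" for x
  proof -
    have "x \<notin> \<sigma>" using that unfolding link_vertices_def link_def by auto
    then show ?thesis using n by simp
  qed
  then show ?thesis unfolding link_poly_def n by simp
qed


section \<open>Lorentzian polynomials with respect to a cone\<close>

text \<open>
  \<^const>\<open>cone\<close> contains the origin, so it is unsuitable for open cones. Openness is relative
  to \<open>\<real>\<^sup>A\<close>.
\<close>

definition open_convex_cone :: "'x set \<Rightarrow> (real ^ 'x::finite) set \<Rightarrow> bool" where
  "open_convex_cone A C \<longleftrightarrow>
     C \<noteq> {} \<and> openin (top_of_set (coord_space A)) C \<and> convex C \<and>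
     (\<forall>t\<in>C. \<forall>c>0. c *\<^sub>R t \<in> C)"

definition homogeneous_poly :: "'x set \<Rightarrow> nat \<Rightarrow> (real ^ 'x::finite \<Rightarrow> real) \<Rightarrow> bool" where
  "homogeneous_poly A k p \<longleftrightarrow>
     real_polynomial_function p \<and> (\<forall>t\<in>coord_space A. \<forall>c. p (c *\<^sub>R t) = c ^ k * p t)"

definition dir_deriv :: "real ^ 'x \<Rightarrow> (real ^ 'x::finite \<Rightarrow> real) \<Rightarrow> real ^ 'x \<Rightarrow> real" where
  "dir_deriv v p t = deriv (\<lambda>s. p (t + s *\<^sub>R v)) 0"

definition hessian :: "(real ^ 'x::finite \<Rightarrow> real) \<Rightarrow> real ^ 'x \<Rightarrow> 'x \<Rightarrow> 'x \<Rightarrow> real" where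
  "hessian p t x y = dir_deriv (axis x 1) (dir_deriv (axis y 1) p) t"

text \<open>
  For \<open>k = 0\<close> and \<open>k = 1\<close> the last condition is void, which leaves the positive constants and the
  linear forms that are positive on \<open>C\<close>. The standing assumption on \<open>C\<close> is part of the definition.
\<close>

definition lorentzian ::
  "'x set \<Rightarrow> (real ^ 'x::finite) set \<Rightarrow> nat \<Rightarrow> (real ^ 'x \<Rightarrow> real) \<Rightarrow> bool" where
  "lorentzian A C k p \<longleftrightarrow>
     open_convex_cone A C \<and> homogeneous_poly A k p \<and>
     (\<forall>vs. length vs = k \<and> set vs \<subseteq> C \<longrightarrow>
        (\<forall>t\<in>coord_space A. foldr dir_deriv vs p t > 0)) \<and>
     (k \<ge> 2 \<longrightarrow>
        (\<forall>vs. length vs = k - 2 \<and> set vs \<subseteq> C \<longrightarrow>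
           (\<forall>t\<in>coord_space A.
              size {#l \<in># spectrum_on A (hessian (foldr dir_deriv vs p) t). l > 0#} \<le> 1)))"

end

theory Submission
  imports Defs
begin

text \<open>
  Hitting sums satisfy a first-passage identity, so the projections along the spins of a face commute.
  Hence the symmetric polarization of \<open>p\<^sub>\<sigma>\<close> obeys the same recursion as \<open>p\<^sub>\<sigma>\<close>, and
  \<open>\<partial>\<^sub>x p\<^sub>\<sigma> = p\<^sub>\<sigma>\<^sub>x \<circ> \<pi>\<^sub>\<sigma>\<^sub>x\<close>. Positivity follows by induction on the codimension.
  For the signature, let \<open>T\<close> be a directional derivative of order \<open>k - 3\<close> seen as a trilinear form, and
  let \<open>v\<close> be in the cone. The forms \<open>T(e\<^sub>x, _, _)\<close> have at most one positive eigenvalue by induction,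
  so they satisfy a reversed Cauchy-Schwarz inequality at \<open>v\<close>; summing it over \<open>x\<close> shows that every
  eigenvalue \<open>l\<close> of the normalized form \<open>T(v, _, _)\<close> satisfies \<open>l \<le> l\<^sup>2\<close>. By connectedness the largest
  eigenvalue, \<open>1\<close>, is simple, and the others are nonpositive. In codimension 2 the Hessian is the
  adjacency form of a bipartite graph minus a diagonal form, and the bound on \<open>\<lambda>\<^sub>2\<close> makes it nonpositive
  on a hyperplane.
\<close>

text \<open>The induction carries nonpositivity on some hyperplane rather than a count of positive
  eigenvalues: this is exactly what reversed Cauchy-Schwarz consumes, and it is turned into a count
  only once, at the end. The form T(e_x, _, _) comes under the induction hypothesis because it is a
  polar form of the link at the face enlarged by x, evaluated on projected vectors, and the
  projection maps cone into cone. The normalization is D_x = T(e_x, v, v) / v_x. With it v is an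
  eigenvector for the eigenvalue 1, and the summed inequality says that T(v, a, a) is at most the
  sum over x of T(e_x, a, v)^2 / D_x, which is l^2 on a normalized eigenvector. The obstacle is that
  diagonal entries of T(v, _, _) can be negative, so the Perron-Frobenius part must rest on an
  identity in which the diagonal cancels. Hitting sums are infinite sums. Once convergence is
  settled they are handled as solutions of a finite linear system. A strictly superharmonic
  function, which exists because of absorption, gives both uniqueness for that system and a point of
  every cone.\<close>

no_notation scalar_prod (infix "\<bullet>" 70)
hide_const (open) Matrix.orthogonal
hide_fact (open) Matrix.orthogonal_def Matrix.vec_eq_iff

section \<open>Spectra of symmetric forms\<close>

text \<open>A maximizer \<open>e\<close> of the Rayleigh quotient on the unit sphere of
  \<open>S\<close> is an eigenvector: the form of \<open>l - f\<close> is nonnegative on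
  \<open>S\<close> and vanishes at \<open>e\<close>, and perturbing \<open>e\<close> along the
  residual \<open>l *\<^sub>R e - f e\<close> would make it negative unless that residual is
  zero.\<close>

lemma self_adjoint_eigenvector:
  fixes f :: "'a::euclidean_space \<Rightarrow> 'a"
  assumes S: "subspace S" "S \<noteq> {0}" and f: "linear f" "f ` S \<subseteq> S"
    and sa: "\<And>x y. x \<in> S \<Longrightarrow> y \<in> S \<Longrightarrow> f x \<bullet> y = x \<bullet> f y"
  obtains e l where "e \<in> S" "norm e = 1" "f e = l *\<^sub>R e"
proof -
  define K where "K = S \<inter> sphere 0 1"
  have "compact K"
    unfolding K_def using closed_subspace[OF S(1)] compact_sphere[of "0::'a" 1]
    by (simp add: closed_Int_compact)
  moreover have "K \<noteq> {}"
  proof -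
    obtain x where x: "x \<in> S" "x \<noteq> 0" using S subspace_0[OF S(1)] by blast
    then have "(1 / norm x) *\<^sub>R x \<in> K" using S(1) by (simp add: K_def subspace_scale)
    then show ?thesis by blast
  qed
  moreover have "continuous_on K (\<lambda>x. f x \<bullet> x)"
    by (intro continuous_intros linear_continuous_on linear_conv_bounded_linear[THEN iffD1] f(1))
  ultimately obtain e where e: "e \<in> K" and max: "\<And>x. x \<in> K \<Longrightarrow> f x \<bullet> x \<le> f e \<bullet> e"
    using continuous_attains_sup[of K "\<lambda>x. f x \<bullet> x"] by blast
  define l where "l = f e \<bullet> e"
  have eS: "e \<in> S" and en: "norm e = 1" using e by (auto simp: K_def)
  have psd: "0 \<le> l * (x \<bullet> x) - f x \<bullet> x" if "x \<in> S" for x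
  proof (cases "x = 0")
    case True then show ?thesis by (simp add: linear_0[OF f(1)])
  next
    case False
    have "(1 / norm x) *\<^sub>R x \<in> K" using that False S(1) by (simp add: K_def subspace_scale)
    then have "f ((1 / norm x) *\<^sub>R x) \<bullet> ((1 / norm x) *\<^sub>R x) \<le> l" using max l_def by blast
    then have "(f x \<bullet> x) / (norm x)^2 \<le> l"
      by (simp add: linear_scale[OF f(1)] power2_eq_square)
    then have "f x \<bullet> x \<le> l * (norm x)^2" using False by (simp add: divide_le_eq)
    then show ?thesis by (simp add: power2_norm_eq_inner)
  qed
  define r where "r = l *\<^sub>R e - f e"
  have rS: "r \<in> S" using S(1) f(2) eS by (auto simp: r_def intro!: subspace_diff subspace_scale)
  define c where "c = l * (r \<bullet> r) - f r \<bullet> r"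
  have c0: "c \<ge> 0" using psd[OF rS] by (simp add: c_def)
  have quad: "0 \<le> s^2 * c + 2 * s * (r \<bullet> r)" for s
  proof -
    have "e + s *\<^sub>R r \<in> S" using eS rS S(1) by (simp add: subspace_add subspace_scale)
    from psd[OF this] have "0 \<le> l * ((e + s *\<^sub>R r) \<bullet> (e + s *\<^sub>R r)) - f (e + s *\<^sub>R r) \<bullet> (e + s *\<^sub>R r)" .
    also have "\<dots> = (l * (e \<bullet> e) - f e \<bullet> e) + 2 * s * (l * (e \<bullet> r) - f e \<bullet> r) + s^2 * c"
      using sa[OF rS eS]
      by (simp add: c_def linear_add[OF f(1)] linear_scale[OF f(1)] algebra_simps inner_commute power2_eq_square)
    also have "l * (e \<bullet> e) - f e \<bullet> e = 0" using en by (simp add: l_def norm_eq_1)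
    also have "l * (e \<bullet> r) - f e \<bullet> r = r \<bullet> r" by (simp add: r_def inner_diff_left)
    finally show ?thesis by simp
  qed
  have "r \<bullet> r = 0"
  proof (rule ccontr)
    assume "r \<bullet> r \<noteq> 0"
    then have p: "r \<bullet> r > 0" by simp
    \<comment> \<open>A negative step, short enough for the linear term to dominate the quadratic
      one; the summand 1 covers \<open>c = 0\<close>.\<close>
    define s where "s = - (r \<bullet> r) / (c + 1)"
    have "s^2 * c + 2 * s * (r \<bullet> r) = (r \<bullet> r)^2 / (c+1) * (c / (c+1) - 2)"
      unfolding s_def by (simp add: power2_eq_square right_diff_distrib)
    moreover have "c / (c+1) - 2 < 0" using c0 by (simp add: field_simps)
    moreover have "(r \<bullet> r)^2 / (c+1) > 0" using p c0 by simp
    ultimately show False using quad[of s] by (smt (verit) mult_pos_neg)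
  qed
  then have "f e = l *\<^sub>R e" by (simp add: r_def)
  then show ?thesis using that eS en by blast
qed

text \<open>By self-adjointness the complement of an eigenvector inside \<open>S\<close> is again
  invariant, so the dimension drops. Working in a subspace serves this induction and also the
  application to \<open>coord_space A\<close>.\<close>

theorem self_adjoint_eigenbasis:
  fixes f :: "'a::euclidean_space \<Rightarrow> 'a"
  assumes "subspace S" "linear f" "f ` S \<subseteq> S"
    and "\<And>x y. x \<in> S \<Longrightarrow> y \<in> S \<Longrightarrow> f x \<bullet> y = x \<bullet> f y"
  shows "\<exists>B d. finite B \<and> B \<subseteq> S \<and> pairwise orthogonal B \<and> (\<forall>b\<in>B. norm b = 1 \<and> f b = d b *\<^sub>R b) \<and> span B = S"
  using assms
proof (induction "dim S" arbitrary: S rule: less_induct)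
  case less
  show ?case
  proof (cases "S = {0}")
    case True
    then show ?thesis by (intro exI[of _ "{}"]) auto
  next
    case False
    obtain e l where e: "e \<in> S" "norm e = 1" "f e = l *\<^sub>R e"
      using self_adjoint_eigenvector[OF less.prems(1) False less.prems(2,3)] less.prems(4) by blast
    define T where "T = {x \<in> S. x \<bullet> e = 0}"
    have T: "subspace T"
      using less.prems(1) by (auto simp: T_def subspace_def inner_left_distrib)
    have TS: "T \<subseteq> S" by (auto simp: T_def)
    have "e \<notin> T" using e by (auto simp: T_def norm_eq_1)
    then have "T \<subset> S" using TS e(1) by blast
    then have "dim T < dim S"
      by (metis T dim_psubset less.prems(1) span_eq_iff)
    moreover have "f ` T \<subseteq> T"
      using less.prems(3,4) e by (force simp: T_def)
    ultimately obtain B d where B: "finite B" "B \<subseteq> T" "pairwise orthogonal B"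
        "\<And>b. b \<in> B \<Longrightarrow> norm b = 1 \<and> f b = d b *\<^sub>R b" "span B = T"
      using less.hyps[of T] T less.prems(2,4) TS by blast
    have eB: "e \<notin> B" using B(2) \<open>e \<notin> T\<close> by blast
    have "pairwise orthogonal (insert e B)"
      using B(2,3) eB by (auto simp: pairwise_insert orthogonal_def T_def inner_commute)
    moreover have "span (insert e B) = S"
    proof
      show "span (insert e B) \<subseteq> S"
        using e(1) B(2) TS less.prems(1) by (intro span_minimal) auto
      show "S \<subseteq> span (insert e B)"
      proof
        fix x assume x: "x \<in> S"
        have "x - (x \<bullet> e) *\<^sub>R e \<in> T"
          using x e less.prems(1) by (auto simp: T_def subspace_diff subspace_scale inner_diff_left norm_eq_1)
        then have "x - (x \<bullet> e) *\<^sub>R e \<in> span (insert e B)"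
          using B(5) span_mono[of B "insert e B"] by blast
        from span_add[OF this span_scale[OF span_base[of e "insert e B"], of "x \<bullet> e"]]
        show "x \<in> span (insert e B)" by simp
      qed
    qed
    ultimately show ?thesis
      using B e eB TS
      by (intro exI[of _ "insert e B"] exI[of _ "d(e := l)"]) auto
  qed
qed

section \<open>Matrices on a finite index set and their spectra\<close>

lemma subspace_coord_space: "subspace (coord_space A)"
  by (auto simp: subspace_def coord_space_def)

lemma coord_spaceD: "t \<in> coord_space A \<Longrightarrow> x \<notin> A \<Longrightarrow> t $ x = 0"
  by (simp add: coord_space_def)

lemma inner_coord_space:
  fixes a :: "real ^ 'x::finite"
  assumes "a \<in> coord_space A"
  shows "a \<bullet> b = (\<Sum>x\<in>A. a $ x * b $ x)" "b \<bullet> a = (\<Sum>x\<in>A. b $ x * a $ x)"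
  unfolding inner_vec_def using coord_spaceD[OF assms]
  by (auto intro!: sum.mono_neutral_right)

lemma dim_coord_space: "dim (coord_space A :: (real ^ 'x::finite) set) = card A"
proof -
  define E where "E = (\<lambda>x. axis x (1::real)) ` A"
  have sub: "E \<subseteq> coord_space A" by (auto simp: E_def coord_space_def axis_def)
  have inj: "inj_on (\<lambda>x. axis x (1::real)) A" by (auto simp: inj_on_def axis_eq_axis)
  have "pairwise orthogonal E" by (auto simp: E_def pairwise_def orthogonal_def inner_axis_axis)
  moreover have "0 \<notin> E" by (auto simp: E_def)
  ultimately have ind: "independent E" by (rule pairwise_orthogonal_independent)
  have "coord_space A \<subseteq> span E"
  proof
    fix t :: "real ^ 'x" assume t: "t \<in> coord_space A"
    have "t = (\<Sum>x\<in>A. t $ x *\<^sub>R axis x 1)"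
      using coord_spaceD[OF t]
      by (auto simp: vec_eq_iff axis_def if_distrib cong: if_cong)
    also have "\<dots> \<in> span E"
      by (intro span_sum span_scale span_base) (auto simp: E_def)
    finally show "t \<in> span E" .
  qed
  then have "dim (coord_space A :: (real ^ 'x) set) = card E"
    using dim_unique[OF sub _ ind] by blast
  then show ?thesis using card_image[OF inj] by (simp add: E_def)
qed

definition mat_op :: "'x set \<Rightarrow> ('x \<Rightarrow> 'x \<Rightarrow> real) \<Rightarrow> real ^ 'x::finite \<Rightarrow> real ^ 'x" where
  "mat_op A M t = (\<chi> x. if x \<in> A then \<Sum>y\<in>A. M x y * t $ y else 0)"

definition quad_form :: "'x set \<Rightarrow> ('x \<Rightarrow> 'x \<Rightarrow> real) \<Rightarrow> real ^ 'x::finite \<Rightarrow> real" where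
  "quad_form A M t = (\<Sum>x\<in>A. \<Sum>y\<in>A. M x y * t $ x * t $ y)"

lemma linear_mat_op: "linear (mat_op A M)"
  by (rule linearI) (auto simp: mat_op_def vec_eq_iff algebra_simps sum.distrib sum_distrib_left)

lemma mat_op_in_coord_space: "mat_op A M t \<in> coord_space A"
  by (simp add: mat_op_def coord_space_def)

lemma inner_mat_op:
  fixes a :: "real ^ 'x::finite"
  assumes "a \<in> coord_space A"
  shows "a \<bullet> mat_op A M a = quad_form A M a"
  unfolding inner_coord_space[OF assms] quad_form_def mat_op_def
  by (simp add: sum_distrib_left mult_ac)

lemma symmetric_eigenbasis:
  fixes M :: "'x::finite \<Rightarrow> 'x \<Rightarrow> real"
  assumes sym: "\<And>x y. x \<in> A \<Longrightarrow> y \<in> A \<Longrightarrow> M x y = M y x"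
  obtains B d where "finite B" "B \<subseteq> coord_space A" "pairwise orthogonal B"
    "\<And>b. b \<in> B \<Longrightarrow> norm b = 1" "\<And>b. b \<in> B \<Longrightarrow> mat_op A M b = d b *\<^sub>R b"
    "span B = coord_space A" "independent B" "card B = card A"
proof -
  have sa: "mat_op A M x \<bullet> y = x \<bullet> mat_op A M y" if "x \<in> coord_space A" "y \<in> coord_space A" for x y
  proof -
    have "mat_op A M x \<bullet> y = (\<Sum>i\<in>A. \<Sum>j\<in>A. M i j * x $ j * y $ i)"
      unfolding inner_coord_space(2)[OF that(2)] by (simp add: mat_op_def sum_distrib_left sum_distrib_right mult_ac)
    also have "\<dots> = (\<Sum>j\<in>A. \<Sum>i\<in>A. M i j * x $ j * y $ i)" by (rule sum.swap)
    also have "\<dots> = (\<Sum>j\<in>A. \<Sum>i\<in>A. M j i * x $ j * y $ i)" using sym by (auto intro!: sum.cong)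
    also have "\<dots> = x \<bullet> mat_op A M y"
      unfolding inner_coord_space(1)[OF that(1)] by (simp add: mat_op_def sum_distrib_left mult_ac)
    finally show ?thesis .
  qed
  have "\<exists>B d. finite B \<and> B \<subseteq> coord_space A \<and> pairwise orthogonal B \<and>
      (\<forall>b\<in>B. norm b = 1 \<and> mat_op A M b = d b *\<^sub>R b) \<and> span B = coord_space A"
    by (rule self_adjoint_eigenbasis[OF subspace_coord_space linear_mat_op _ sa])
      (auto simp: mat_op_in_coord_space)
  then obtain B d where B: "finite B" "B \<subseteq> coord_space A" "pairwise orthogonal B"
    "\<forall>b\<in>B. norm b = 1 \<and> mat_op A M b = d b *\<^sub>R b" "span B = coord_space A"
    by auto
  have "0 \<notin> B" using B(4) by force
  then have ind: "independent B" using pairwise_orthogonal_independent B(3) by blast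
  then have "card B = card A"
    using dim_coord_space[of A] B(5) dim_span_eq_card_independent[OF ind] by simp
  then show ?thesis using that B ind by blast
qed

lemma quad_form_expand:
  fixes M :: "'x::finite \<Rightarrow> 'x \<Rightarrow> real"
  assumes B: "finite B" "pairwise orthogonal B" "\<And>b. b \<in> B \<Longrightarrow> norm b = 1"
    "\<And>b. b \<in> B \<Longrightarrow> mat_op A M b = d b *\<^sub>R b" "span B = coord_space A"
    and a: "a \<in> coord_space A"
  shows "quad_form A M a = (\<Sum>b\<in>B. d b * (a \<bullet> b)\<^sup>2)" "a \<bullet> a = (\<Sum>b\<in>B. (a \<bullet> b)\<^sup>2)"
proof -
  have ex: "(\<Sum>b\<in>B. (a \<bullet> b) *\<^sub>R b) = a"
    using orthonormal_basis_expand[OF B(2,3) _ B(1)] a B(5) by simp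
  have "mat_op A M a = (\<Sum>b\<in>B. (a \<bullet> b) *\<^sub>R mat_op A M b)"
    by (subst ex[symmetric]) (simp add: linear_sum[OF linear_mat_op] linear_scale[OF linear_mat_op])
  also have "\<dots> = (\<Sum>b\<in>B. ((a \<bullet> b) * d b) *\<^sub>R b)" using B(4) by simp
  finally have "a \<bullet> mat_op A M a = (\<Sum>b\<in>B. d b * (a \<bullet> b)\<^sup>2)"
    by (simp add: inner_sum_right power2_eq_square mult_ac)
  then show "quad_form A M a = (\<Sum>b\<in>B. d b * (a \<bullet> b)\<^sup>2)" using inner_mat_op[OF a] by simp
  have "a \<bullet> (\<Sum>b\<in>B. (a \<bullet> b) *\<^sub>R b) = (\<Sum>b\<in>B. (a \<bullet> b)\<^sup>2)"
    by (simp add: inner_sum_right power2_eq_square)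
  then show "a \<bullet> a = (\<Sum>b\<in>B. (a \<bullet> b)\<^sup>2)" using ex by simp
qed

text \<open>The matrix \<open>Q\<close> whose columns are the basis vectors conjugates the
  enumerated matrix to a diagonal one, and similar matrices share the characteristic polynomial.
  Neither symmetry nor orthogonality is assumed, so that the lemma also covers walk
  matrices.\<close>

lemma spectrum_on_eigenbasis:
  fixes M :: "'x::finite \<Rightarrow> 'x \<Rightarrow> real"
  assumes B: "B \<subseteq> coord_space A" "independent B" "card B = card A"
    and eig: "\<And>b. b \<in> B \<Longrightarrow> mat_op A M b = d b *\<^sub>R b"
  shows "spectrum_on A M = image_mset d (mset_set B)"
proof -
  define n where "n = card A"
  have fB: "finite B" using B(2) by (rule independent_imp_finite)
  define a where "a = from_nat_into A"
  define b where "b = from_nat_into B"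
  have a: "bij_betw a {..<n} A"
    unfolding a_def n_def using bij_betw_from_nat_into_finite[of A] by simp
  have b: "bij_betw b {..<n} B"
    unfolding b_def n_def using bij_betw_from_nat_into_finite[OF fB] B(3) by simp
  define MM where "MM = Matrix.mat n n (\<lambda>(i,j). M (a i) (a j))"
  define Q where "Q = Matrix.mat n n (\<lambda>(i,j). b j $ a i)"
  define D where "D = Matrix.mat n n (\<lambda>(i,j). if i = j then d (b i) else 0)"
  have carr[simp]: "MM \<in> carrier_mat n n" "Q \<in> carrier_mat n n" "D \<in> carrier_mat n n"
    by (auto simp: MM_def Q_def D_def)
  have bB: "b j \<in> B" if "j < n" for j using b that by (auto simp: bij_betw_def)
  have aA: "a j \<in> A" if "j < n" for j using a that by (auto simp: bij_betw_def)
  have "MM * Q = Q * D"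
  proof (rule eq_matI)
    fix i j assume "i < dim_row (Q * D)" "j < dim_col (Q * D)"
    then have ij: "i < n" "j < n" by (auto simp: Q_def D_def)
    have "(MM * Q) $$ (i, j) = (\<Sum>k<n. M (a i) (a k) * b j $ a k)"
      using ij by (simp add: MM_def Q_def scalar_prod_def atLeast0LessThan)
    also have "\<dots> = (\<Sum>y\<in>A. M (a i) y * b j $ y)"
      by (rule sum.reindex_bij_betw[OF a])
    also have "\<dots> = mat_op A M (b j) $ a i" using aA[OF ij(1)] by (simp add: mat_op_def)
    also have "\<dots> = b j $ a i * d (b j)" using eig[OF bB[OF ij(2)]] by simp
    also have "\<dots> = (\<Sum>k<n. b k $ a i * (if k = j then d (b k) else 0))"
      using ij(2) by (simp add: if_distrib cong: if_cong)
    also have "\<dots> = (Q * D) $$ (i, j)"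
      using ij by (simp add: D_def Q_def scalar_prod_def atLeast0LessThan)
    finally show "(MM * Q) $$ (i, j) = (Q * D) $$ (i, j)" .
  qed (auto simp: MM_def Q_def D_def)
  \<comment> \<open>A kernel vector of \<open>Q\<close> is a linear relation among the vectors of
    \<open>B\<close>: the rows give its coordinates in \<open>A\<close>, and the other coordinates
    vanish anyway.\<close>
  have "Determinant.det Q \<noteq> 0"
  proof
    assume "Determinant.det Q = 0"
    then obtain v where v: "v \<in> carrier_vec n" "v \<noteq> 0\<^sub>v n" "Q *\<^sub>v v = 0\<^sub>v n"
      using det_0_iff_vec_prod_zero[of Q n] by auto
    have "(\<Sum>j<n. vec_index v j *\<^sub>R b j) $ x = 0" for x
    proof (cases "x \<in> A")
      case True
      then obtain i where i: "i < n" "x = a i" using a by (auto simp: bij_betw_def)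
      have "vec_index (Q *\<^sub>v v) i = (\<Sum>j<n. b j $ a i * vec_index v j)"
        using i v(1) by (simp add: Q_def scalar_prod_def atLeast0LessThan)
      then show ?thesis using v(3) i by (simp add: mult.commute)
    next
      case False
      then show ?thesis using bB B(1) by (force intro: sum.neutral dest: coord_spaceD)
    qed
    then have "(\<Sum>j<n. vec_index v j *\<^sub>R b j) = 0" by (simp add: vec_eq_iff)
    moreover have "(\<Sum>j<n. vec_index v j *\<^sub>R b j) = (\<Sum>z\<in>B. vec_index v (the_inv_into {..<n} b z) *\<^sub>R z)"
      unfolding sum.reindex_bij_betw[OF b, symmetric]
      using b by (auto intro!: sum.cong simp: bij_betw_def the_inv_into_f_f)
    ultimately have z: "\<And>z. z \<in> B \<Longrightarrow> vec_index v (the_inv_into {..<n} b z) = 0"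
      using independentD[OF B(2) fB subset_refl] by simp
    have "vec_index v j = 0" if "j < n" for j
      using z[OF bB[OF that]] b that by (simp add: bij_betw_def the_inv_into_f_f)
    then have "v = 0\<^sub>v n" using v(1) by (intro eq_vecI) auto
    then show False using v(2) by simp
  qed
  then obtain R where R: "R \<in> carrier_mat n n" "Q * R = 1\<^sub>m n" "R * Q = 1\<^sub>m n"
    using det_non_zero_imp_unit[of Q n "()"] by (auto simp: Units_def ring_mat_def)
  have "MM = MM * (Q * R)" using R right_mult_one_mat[of MM n n] by simp
  also have "\<dots> = Q * D * R" using \<open>MM * Q = Q * D\<close> R(1) carr
    by (metis assoc_mult_mat)
  finally have MM: "MM = Q * D * R" .
  have "similar_mat MM D" by (rule similar_matI[OF _ R(2,3) MM]) (simp add: R(1))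
  then have "char_poly MM = char_poly D" by (rule char_poly_similar)
  also have "\<dots> = (\<Prod>a\<leftarrow>diag_mat D. [:- a, 1:])"
    by (rule char_poly_upper_triangular[of _ n]) (auto simp: D_def)
  also have "diag_mat D = map (\<lambda>i. d (b i)) [0..<n]" by (simp add: diag_mat_def D_def)
  also have "(\<Prod>a\<leftarrow>map (\<lambda>i. d (b i)) [0..<n]. [:- a, 1:]) = (\<Prod>i<n. [:- d (b i), 1:])"
    by (simp add: prod.distinct_set_conv_list[symmetric] comp_def atLeast0LessThan)
  also have "\<dots> = (\<Prod>z\<in>B. [:- d z, 1:])" by (rule prod.reindex_bij_betw[OF b])
  finally have "proots (char_poly MM) = (\<Sum>z\<in>B. proots [:- d z, 1:])"
    by (simp add: proots_prod)
  also have "\<dots> = (\<Sum>z\<in>B. {#d z#})" by (simp del: proots_linear_factor add: proots_linear_factor[of "- _"])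
  also have "\<dots> = image_mset d (mset_set B)"
    using fB by (induction B rule: finite_induct) auto
  finally show ?thesis
    unfolding spectrum_on_def MM_def n_def a_def .
qed

text \<open>Two eigenvectors with positive eigenvalues would span a plane on which the form is
  positive definite, and every plane meets the hyperplane orthogonal to \<open>c\<close>.\<close>

lemma one_positive_eigenvalue:
  fixes M :: "'x::finite \<Rightarrow> 'x \<Rightarrow> real"
  assumes sym: "\<And>x y. x \<in> A \<Longrightarrow> y \<in> A \<Longrightarrow> M x y = M y x"
    and neg: "\<And>a. a \<in> coord_space A \<Longrightarrow> c \<bullet> a = 0 \<Longrightarrow> quad_form A M a \<le> 0"
  shows "size {#l \<in># spectrum_on A M. l > 0#} \<le> 1"
proof -
  obtain B d where B: "finite B" "B \<subseteq> coord_space A" "pairwise orthogonal B"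
    "\<And>b. b \<in> B \<Longrightarrow> norm b = 1" "\<And>b. b \<in> B \<Longrightarrow> mat_op A M b = d b *\<^sub>R b"
    "span B = coord_space A" "independent B" "card B = card A"
    using symmetric_eigenbasis[of A M] sym by metis
  define P where "P = {b \<in> B. d b > 0}"
  have "finite P" using B(1) by (simp add: P_def)
  have qf: "quad_form A M (s *\<^sub>R x + t *\<^sub>R y) = s\<^sup>2 * d x + t\<^sup>2 * d y"
    if "x \<in> B" "y \<in> B" "x \<noteq> y" for s t x y
  proof -
    have "s *\<^sub>R x + t *\<^sub>R y \<in> coord_space A"
      using that B(2) subspace_coord_space by (auto intro!: subspace_add subspace_scale)
    moreover have ip: "b \<bullet> b' = (if b = b' then 1 else 0)" if "b \<in> B" "b' \<in> B" for b b'
      using B(3,4) that by (auto simp: pairwise_def orthogonal_def norm_eq_1)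
    ultimately have "quad_form A M (s *\<^sub>R x + t *\<^sub>R y)
        = (s *\<^sub>R x + t *\<^sub>R y) \<bullet> mat_op A M (s *\<^sub>R x + t *\<^sub>R y)" by (simp add: inner_mat_op)
    also have "\<dots> = s\<^sup>2 * d x + t\<^sup>2 * d y"
      using that B(5) ip[of x x] ip[of x y] ip[of y x] ip[of y y]
      by (simp add: linear_add[OF linear_mat_op] linear_scale[OF linear_mat_op]
          inner_left_distrib inner_right_distrib power2_eq_square)
    finally show ?thesis .
  qed
  have "x = y" if xy: "x \<in> P" "y \<in> P" for x y
  proof (rule ccontr)
    assume ne: "x \<noteq> y"
    \<comment> \<open>A nonzero combination orthogonal to \<open>c\<close>: \<open>x\<close> itself
      if possible, otherwise \<open>x\<close> and \<open>y\<close> weighted crosswise.\<close>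
    define s t where "s = (if c \<bullet> x = 0 then 1 else c \<bullet> y)" and "t = (if c \<bullet> x = 0 then 0 else - (c \<bullet> x))"
    have "c \<bullet> (s *\<^sub>R x + t *\<^sub>R y) = 0" by (auto simp: s_def t_def inner_right_distrib)
    moreover have "s *\<^sub>R x + t *\<^sub>R y \<in> coord_space A"
      using xy B(2) subspace_coord_space by (auto simp: P_def intro!: subspace_add subspace_scale)
    ultimately have le: "s\<^sup>2 * d x + t\<^sup>2 * d y \<le> 0" using neg[of "s *\<^sub>R x + t *\<^sub>R y"] qf[OF _ _ ne] xy by (simp add: P_def)
    have "s \<noteq> 0 \<or> t \<noteq> 0" by (auto simp: s_def t_def)
    moreover have "d x > 0" "d y > 0" using xy by (auto simp: P_def)
    ultimately have "s\<^sup>2 * d x + t\<^sup>2 * d y > 0"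
      by (metis add_pos_nonneg add_nonneg_pos mult_pos_pos zero_less_power2 less_imp_le mult_nonneg_nonneg zero_le_power2)
    then show False using le by simp
  qed
  then have "card P \<le> 1" using \<open>finite P\<close> by (metis One_nat_def card_le_Suc0_iff_eq)
  moreover have "{#l \<in># spectrum_on A M. l > 0#} = image_mset d (mset_set P)"
    using B(1) spectrum_on_eigenbasis[of B A M d] B(2,5,7,8)
    by (simp add: P_def filter_mset_image_mset filter_mset_mset_set)
  ultimately show ?thesis by simp
qed

text \<open>Only one copy of the maximum \<open>m\<close> is split off. Further copies stay in
  \<open>N\<close>, so a multiple top eigenvalue is counted correctly; an element of
  \<open>N\<close> also guarantees that index 1 exists.\<close>

lemma lambda2_add_mset:
  assumes sp: "spectrum_on A M = add_mset m N" and "\<And>l. l \<in># N \<Longrightarrow> l \<le> m" "l \<in># N"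
  shows "l \<le> lambda2 A M"
proof -
  have "sorted_list_of_multiset (add_mset m N) = sorted_list_of_multiset N @ [m]"
  proof -
    have "sorted (sorted_list_of_multiset N @ [m])"
      using assms(2) by (simp add: sorted_append)
    then have "sort (sorted_list_of_multiset N @ [m]) = sorted_list_of_multiset N @ [m]"
      by (rule sorted_sort_id)
    moreover have "mset (sorted_list_of_multiset N @ [m]) = add_mset m N" by simp
    ultimately show ?thesis by (metis sorted_list_of_multiset_mset)
  qed
  moreover have ne: "sorted_list_of_multiset N \<noteq> []" using assms(3)
    by (metis mset.simps(1) mset_sorted_list_of_multiset empty_iff set_mset_empty)
  ultimately have "lambda2 A M = last (sorted_list_of_multiset N)"
    unfolding lambda2_def sp by (simp add: rev_nth last_conv_nth)
  moreover have "l \<le> last (sorted_list_of_multiset N)"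
  proof -
    define L where "L = sorted_list_of_multiset N"
    have "l \<in> set L" using assms(3) by (simp add: L_def)
    then obtain i where i: "i < length L" "l = L ! i" by (auto simp: in_set_conv_nth)
    have "sorted L" by (simp add: L_def)
    then have "L ! i \<le> L ! (length L - 1)" using i(1) by (intro sorted_nth_mono) auto
    then show ?thesis using i ne by (simp add: last_conv_nth L_def)
  qed
  ultimately show ?thesis by simp
qed

section \<open>Weighted forms: Perron-Frobenius, the second eigenvalue, bipartite graphs\<close>

text \<open>
  The diagonal terms of \<open>M\<close> cancel, so only the off-diagonal entries need to be nonnegative.
\<close>

lemma dirichlet_form_identity:
  fixes M :: "'x::finite \<Rightarrow> 'x \<Rightarrow> real"
  assumes sym: "\<And>x y. x \<in> A \<Longrightarrow> y \<in> A \<Longrightarrow> M x y = M y x"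
    and w: "\<And>x. x \<in> A \<Longrightarrow> w x > 0"
    and eig: "\<And>x. x \<in> A \<Longrightarrow> (\<Sum>y\<in>A. M x y * w y) = D x * w x"
  shows "2 * ((\<Sum>x\<in>A. D x * (a $ x)\<^sup>2) - quad_form A M a)
    = (\<Sum>x\<in>A. \<Sum>y\<in>A. M x y * w x * w y * (a $ x / w x - a $ y / w y)\<^sup>2)"
proof -
  have t: "M x y * w x * w y * (a $ x / w x - a $ y / w y)\<^sup>2
      = (M x y * w y) * ((a $ x)\<^sup>2 / w x) + (M x y * w x) * ((a $ y)\<^sup>2 / w y) - 2 * (M x y * a $ x * a $ y)"
    if "x \<in> A" "y \<in> A" for x y
    using w[OF that(1)] w[OF that(2)] by (simp add: power2_eq_square field_simps)
  have 1: "(\<Sum>x\<in>A. \<Sum>y\<in>A. (M x y * w y) * ((a $ x)\<^sup>2 / w x)) = (\<Sum>x\<in>A. D x * (a $ x)\<^sup>2)"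
  proof (rule sum.cong[OF refl])
    fix x assume x: "x \<in> A"
    have "(\<Sum>y\<in>A. (M x y * w y) * ((a $ x)\<^sup>2 / w x)) = D x * w x * ((a $ x)\<^sup>2 / w x)"
      unfolding sum_distrib_right[symmetric] eig[OF x] ..
    then show "(\<Sum>y\<in>A. (M x y * w y) * ((a $ x)\<^sup>2 / w x)) = D x * (a $ x)\<^sup>2"
      using w[OF x] by simp
  qed
  have "(\<Sum>x\<in>A. \<Sum>y\<in>A. (M x y * w x) * ((a $ y)\<^sup>2 / w y)) = (\<Sum>y\<in>A. \<Sum>x\<in>A. (M x y * w x) * ((a $ y)\<^sup>2 / w y))"
    by (rule sum.swap)
  also have "\<dots> = (\<Sum>y\<in>A. \<Sum>x\<in>A. (M y x * w x) * ((a $ y)\<^sup>2 / w y))"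
    using sym by (auto intro!: sum.cong)
  finally have 2: "(\<Sum>x\<in>A. \<Sum>y\<in>A. (M x y * w x) * ((a $ y)\<^sup>2 / w y)) = (\<Sum>x\<in>A. D x * (a $ x)\<^sup>2)"
    using 1 by simp
  have "(\<Sum>x\<in>A. \<Sum>y\<in>A. M x y * w x * w y * (a $ x / w x - a $ y / w y)\<^sup>2)
    = (\<Sum>x\<in>A. \<Sum>y\<in>A. (M x y * w y) * ((a $ x)\<^sup>2 / w x) + (M x y * w x) * ((a $ y)\<^sup>2 / w y) - 2 * (M x y * a $ x * a $ y))"
    using t by (intro sum.cong refl) simp
  also have "\<dots> = 2 * ((\<Sum>x\<in>A. D x * (a $ x)\<^sup>2) - quad_form A M a)"
    unfolding sum.distrib sum_subtractf 1 2 sum_distrib_left[symmetric] quad_form_def by simp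
  finally show ?thesis by simp
qed

text \<open>The eigenbasis of \<open>D\<^sup>-\<^sup>1 M\<close>, orthonormal for the inner product with weights \<open>D\<close>.\<close>

lemma weighted_eigenbasis:
  fixes M :: "'x::finite \<Rightarrow> 'x \<Rightarrow> real"
  assumes sym: "\<forall>x\<in>A. \<forall>y\<in>A. M x y = M y x" and D: "\<forall>x\<in>A. D x > 0"
  shows "\<exists>B d. finite B \<and> B \<subseteq> coord_space A \<and> independent B \<and> card B = card A \<and>
    (\<forall>b\<in>B. \<forall>x\<in>A. (\<Sum>y\<in>A. M x y * b $ y) = d b * D x * b $ x) \<and>
    (\<forall>b\<in>B. (\<Sum>x\<in>A. D x * (b $ x)\<^sup>2) = 1) \<and>
    (\<forall>a. quad_form A M a = (\<Sum>b\<in>B. d b * (\<Sum>x\<in>A. D x * a $ x * b $ x)\<^sup>2)) \<and>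
    (\<forall>a. (\<Sum>x\<in>A. D x * (a $ x)\<^sup>2) = (\<Sum>b\<in>B. (\<Sum>x\<in>A. D x * a $ x * b $ x)\<^sup>2))"
proof -
  define r where "r x = sqrt (D x)" for x
  have r: "r x > 0" "r x * r x = D x" if "x \<in> A" for x
    using D that by (auto simp: r_def)
  \<comment> \<open>The usual symmetrization by the square roots of \<open>D\<close>. Dividing by
    these roots (\<open>dn\<close>) carries an orthonormal eigenbasis of \<open>N\<close> to the
    desired one, and \<open>up\<close> undoes it.\<close>
  define N where "N x y = M x y / (r x * r y)" for x y
  have Nsym: "N x y = N y x" if "x \<in> A" "y \<in> A" for x y
    using sym that by (simp add: N_def mult.commute)
  obtain B d where B: "finite B" "B \<subseteq> coord_space A" "pairwise orthogonal B"
    "\<And>b. b \<in> B \<Longrightarrow> norm b = 1" "\<And>b. b \<in> B \<Longrightarrow> mat_op A N b = d b *\<^sub>R b"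
    "span B = coord_space A" "independent B" "card B = card A"
    using symmetric_eigenbasis[of A N] Nsym by metis
  define up where "up t = (\<chi> x. if x \<in> A then r x * t $ x else 0)" for t :: "real ^ 'x"
  define dn where "dn t = (\<chi> x. if x \<in> A then t $ x / r x else 0)" for t :: "real ^ 'x"
  have updn: "up (dn t) = t" if "t \<in> coord_space A" for t
    using that r(1) by (force simp: up_def dn_def vec_eq_iff coord_space_def)
  have up: "up t \<in> coord_space A" for t by (simp add: up_def coord_space_def)
  have dn: "dn t \<in> coord_space A" for t by (simp add: dn_def coord_space_def)
  have lin: "linear dn" "linear up"
    by (rule linearI; auto simp: dn_def up_def vec_eq_iff add_divide_distrib algebra_simps)+
  have inj: "inj_on dn (coord_space A)" using updn by (metis inj_on_inverseI)
  have ip: "up a \<bullet> b = (\<Sum>x\<in>A. D x * a $ x * dn b $ x)" for a b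
    unfolding inner_coord_space(1)[OF up]
  proof (rule sum.cong[OF refl])
    fix x assume x: "x \<in> A"
    show "up a $ x * b $ x = D x * a $ x * dn b $ x"
      using x r(1)[OF x] r(2)[OF x, symmetric] by (simp add: up_def dn_def)
  qed
  have qf: "quad_form A N (up a) = quad_form A M a" for a
    unfolding quad_form_def up_def N_def
  proof (intro sum.cong refl)
    fix x y assume "x \<in> A" "y \<in> A"
    then show "M x y / (r x * r y) * (\<chi> x. if x \<in> A then r x * a $ x else 0) $ x *
      (\<chi> x. if x \<in> A then r x * a $ x else 0) $ y = M x y * a $ x * a $ y"
      using r(1)[of x] r(1)[of y] by simp
  qed
  have nm: "up a \<bullet> up a = (\<Sum>x\<in>A. D x * (a $ x)\<^sup>2)" for a
    unfolding inner_coord_space(1)[OF up]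
  proof (rule sum.cong[OF refl])
    fix x assume x: "x \<in> A"
    show "up a $ x * up a $ x = D x * (a $ x)\<^sup>2"
      using x r(2)[OF x, symmetric] by (simp add: up_def power2_eq_square)
  qed
  have injB: "inj_on dn B" using inj B(2) by (rule inj_on_subset)
  have ex: "quad_form A M a = (\<Sum>b\<in>B. d b * (\<Sum>x\<in>A. D x * a $ x * dn b $ x)\<^sup>2)"
      "(\<Sum>x\<in>A. D x * (a $ x)\<^sup>2) = (\<Sum>b\<in>B. (\<Sum>x\<in>A. D x * a $ x * dn b $ x)\<^sup>2)" for a
    subgoal using quad_form_expand(1)[OF B(1,3,4,5,6) up, of a] by (simp add: qf ip)
    subgoal unfolding nm[symmetric] ip[symmetric] using quad_form_expand(2)[OF B(1,3,4,5,6) up, of a] .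
    done
  show ?thesis
  proof (intro exI[of _ "dn ` B"] exI[of _ "\<lambda>b. d (up b)"] conjI ballI allI)
    have upB: "up (dn b) = b" if "b \<in> B" for b using updn B(2) that by blast
    show "finite (dn ` B)" using B(1) by simp
    show "dn ` B \<subseteq> coord_space A" using dn by blast
    show "independent (dn ` B)"
      using linear_independent_injective_image[OF lin(1) B(7)] inj B(6) by simp
    show "card (dn ` B) = card A" using card_image[OF injB] B(8) by simp
    show "(\<Sum>y\<in>A. M x y * b $ y) = d (up b) * D x * b $ x" if b: "b \<in> dn ` B" and x: "x \<in> A" for b x
    proof -
      obtain c where c: "c \<in> B" "b = dn c" using b by blast
      have "r x * mat_op A N c $ x = (\<Sum>y\<in>A. M x y * b $ y)"
        unfolding mat_op_def using x
      proof (simp add: sum_distrib_left, intro sum.cong refl)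
        fix y assume y: "y \<in> A"
        show "r x * (N x y * c $ y) = M x y * b $ y"
          using x y r(1)[OF x] r(1)[OF y] c by (simp add: N_def dn_def)
      qed
      moreover have "mat_op A N c $ x = d c * c $ x" using B(5)[OF c(1)] by simp
      moreover have "r x * c $ x = D x * b $ x"
        using x r(1)[OF x] r(2)[OF x, symmetric] c by (simp add: dn_def)
      ultimately show ?thesis using upB[OF c(1)] c(2) by (simp add: mult_ac)
    qed
    show "(\<Sum>x\<in>A. D x * (b $ x)\<^sup>2) = 1" if b: "b \<in> dn ` B" for b
      using b B(4) upB by (auto simp: nm[symmetric] norm_eq_1)
    show "quad_form A M a = (\<Sum>b\<in>dn ` B. d (up b) * (\<Sum>x\<in>A. D x * a $ x * b $ x)\<^sup>2)" for a
      unfolding sum.reindex[OF injB] comp_def using ex(1)[of a] upB by simp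
    show "(\<Sum>x\<in>A. D x * (a $ x)\<^sup>2) = (\<Sum>b\<in>dn ` B. (\<Sum>x\<in>A. D x * a $ x * b $ x)\<^sup>2)" for a
      unfolding sum.reindex[OF injB] comp_def using ex(2)[of a] .
  qed
qed

text \<open>Perron-Frobenius for \<open>M\<close> relative to \<open>D\<close>, with positive
  eigenvector \<open>w\<close>. All off-diagonal terms of the identity are nonnegative and its
  diagonal terms are zero. In the equality case each term vanishes, so \<open>a / w\<close> does not
  change along an edge.\<close>

lemma dirichlet_form_le:
  fixes M :: "'x::finite \<Rightarrow> 'x \<Rightarrow> real"
  assumes sym: "\<And>x y. x \<in> A \<Longrightarrow> y \<in> A \<Longrightarrow> M x y = M y x"
    and w: "\<And>x. x \<in> A \<Longrightarrow> w x > 0"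
    and eig: "\<And>x. x \<in> A \<Longrightarrow> (\<Sum>y\<in>A. M x y * w y) = D x * w x"
    and off: "\<And>x y. x \<in> A \<Longrightarrow> y \<in> A \<Longrightarrow> x \<noteq> y \<Longrightarrow> M x y \<ge> 0"
  shows "quad_form A M a \<le> (\<Sum>x\<in>A. D x * (a $ x)\<^sup>2)"
    and "\<lbrakk>quad_form A M a = (\<Sum>x\<in>A. D x * (a $ x)\<^sup>2); x \<in> A; y \<in> A; M x y > 0; x \<noteq> y\<rbrakk>
      \<Longrightarrow> a $ x / w x = a $ y / w y"
proof -
  have nn: "0 \<le> M x y * w x * w y * (a $ x / w x - a $ y / w y)\<^sup>2" if "x \<in> A" "y \<in> A" for x y
    using off[OF that] w[OF that(1)] w[OF that(2)] by (cases "x = y") auto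
  note id = dirichlet_form_identity[of A M w D a, OF sym w eig]
  have "0 \<le> 2 * ((\<Sum>x\<in>A. D x * (a $ x)\<^sup>2) - quad_form A M a)"
    using id nn by (simp add: sum_nonneg)
  then show "quad_form A M a \<le> (\<Sum>x\<in>A. D x * (a $ x)\<^sup>2)" by simp
  assume eq: "quad_form A M a = (\<Sum>x\<in>A. D x * (a $ x)\<^sup>2)" and xy: "x \<in> A" "y \<in> A" "M x y > 0" "x \<noteq> y"
  have "(\<Sum>x\<in>A. \<Sum>y\<in>A. M x y * w x * w y * (a $ x / w x - a $ y / w y)\<^sup>2) = 0"
    using id eq by simp
  then have "(\<Sum>y\<in>A. M x y * w x * w y * (a $ x / w x - a $ y / w y)\<^sup>2) = 0"
    using nn xy(1) by (subst (asm) sum_nonneg_eq_0_iff) (auto intro!: sum_nonneg)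
  then have "M x y * w x * w y * (a $ x / w x - a $ y / w y)\<^sup>2 = 0"
    using nn xy(1,2) by (subst (asm) sum_nonneg_eq_0_iff) auto
  then show "a $ x / w x = a $ y / w y" using xy w[of x] w[of y] by auto
qed

text \<open>Courant-Fischer for the walk with conductances \<open>w\<close>: constants are
  eigenvectors for the top eigenvalue 1, and \<open>f\<close> is orthogonal to them in the inner
  product weighted by \<open>D\<close>.\<close>

lemma lambda2_variational:
  fixes w :: "'x::finite \<Rightarrow> 'x \<Rightarrow> real"
  assumes sym: "\<And>x y. x \<in> A \<Longrightarrow> y \<in> A \<Longrightarrow> w x y = w y x"
    and nonneg: "\<And>x y. x \<in> A \<Longrightarrow> y \<in> A \<Longrightarrow> w x y \<ge> 0"
    and D: "\<And>x. x \<in> A \<Longrightarrow> D x = (\<Sum>y\<in>A. w x y)" "\<And>x. x \<in> A \<Longrightarrow> D x > 0"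
    and card: "card A \<ge> 2"
    and f: "(\<Sum>x\<in>A. D x * f $ x) = 0"
  shows "quad_form A w f \<le> lambda2 A (\<lambda>x y. w x y / D x) * (\<Sum>x\<in>A. D x * (f $ x)\<^sup>2)"
proof -
  define l2 where "l2 = lambda2 A (\<lambda>x y. w x y / D x)"
  have s: "\<forall>x\<in>A. \<forall>y\<in>A. w x y = w y x" and p: "\<forall>x\<in>A. D x > 0"
    using sym D(2) by auto
  obtain B d where B: "finite B" "B \<subseteq> coord_space A" "independent B" "card B = card A"
    and eig: "\<forall>b\<in>B. \<forall>x\<in>A. (\<Sum>y\<in>A. w x y * b $ y) = d b * D x * b $ x"
    and norm: "\<forall>b\<in>B. (\<Sum>x\<in>A. D x * (b $ x)\<^sup>2) = 1"
    and qf: "\<forall>a. quad_form A w a = (\<Sum>b\<in>B. d b * (\<Sum>x\<in>A. D x * a $ x * b $ x)\<^sup>2)"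
    and nm: "\<forall>a. (\<Sum>x\<in>A. D x * (a $ x)\<^sup>2) = (\<Sum>b\<in>B. (\<Sum>x\<in>A. D x * a $ x * b $ x)\<^sup>2)"
    using weighted_eigenbasis[OF s p] by (elim exE conjE) (rule that; assumption)
  note eig = eig[rule_format] and norm = norm[rule_format] and qf = qf[rule_format] and nm = nm[rule_format]
  have le: "quad_form A w a \<le> (\<Sum>x\<in>A. D x * (a $ x)\<^sup>2)" for a
    by (rule dirichlet_form_le(1)[where w = "\<lambda>_. 1"]) (use sym nonneg D(1) in auto)
  have qb: "quad_form A w b = d b" if "b \<in> B" for b
  proof -
    have "quad_form A w b = (\<Sum>x\<in>A. b $ x * (\<Sum>y\<in>A. w x y * b $ y))"
      by (simp add: quad_form_def sum_distrib_left mult_ac)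
    also have "\<dots> = d b * (\<Sum>x\<in>A. D x * (b $ x)\<^sup>2)"
      using eig[OF that] by (simp add: sum_distrib_left power2_eq_square mult_ac)
    finally show ?thesis using norm[OF that] by simp
  qed
  have d1: "d b \<le> 1" if "b \<in> B" for b
    using le[of b] qb[OF that] norm[OF that] by simp
  define I where "I b = (\<Sum>x\<in>A. D x * b $ x)" for b :: "real ^ 'x"
  \<comment> \<open>\<open>I b\<close> is the weighted inner product of \<open>b\<close> with the
    constant 1, an eigenvector for 1; different eigenvalues make it vanish.\<close>
  have I0: "I b = 0" if b: "b \<in> B" "d b \<noteq> 1" for b
  proof -
    have "d b * I b = (\<Sum>x\<in>A. \<Sum>y\<in>A. w x y * b $ y)"
      using eig[OF b(1)] by (simp add: I_def sum_distrib_left mult_ac)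
    also have "\<dots> = (\<Sum>y\<in>A. \<Sum>x\<in>A. w x y * b $ y)" by (rule sum.swap)
    also have "\<dots> = (\<Sum>y\<in>A. \<Sum>x\<in>A. w y x * b $ y)" using sym by (auto intro!: sum.cong)
    also have "\<dots> = I b" using D(1) by (simp add: I_def sum_distrib_right)
    finally show ?thesis using b(2) by simp
  qed
  have fin: "finite A" by simp
  have ne: "A \<noteq> {}" using card by auto
  have Dpos: "(\<Sum>x\<in>A. D x) > 0" using D(2) ne fin by (intro sum_pos) auto
  have nmI: "(\<Sum>x\<in>A. D x) = (\<Sum>b\<in>B. (I b)\<^sup>2)"
    using nm[of "\<chi> x. 1"] by (simp add: I_def)
  \<comment> \<open>If no basis vector had eigenvalue 1, the constant vector would be orthogonal to
    the whole basis.\<close>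
  obtain c where c: "c \<in> B" "d c = 1"
  proof (rule ccontr)
    assume "\<not> thesis"
    then have "(\<Sum>b\<in>B. (I b)\<^sup>2) = 0" using I0 that by (intro sum.neutral) auto
    then show False using nmI Dpos by simp
  qed
  have "spectrum_on A (\<lambda>x y. w x y / D x) = image_mset d (mset_set B)"
  proof (rule spectrum_on_eigenbasis[OF B(2,3,4)])
    fix b assume b: "b \<in> B"
    have "(\<Sum>y\<in>A. w x y / D x * b $ y) = d b * b $ x" if "x \<in> A" for x
      using eig[OF b that] D(2)[OF that] by (simp add: sum_divide_distrib[symmetric] field_simps)
    moreover have "b $ x = 0" if "x \<notin> A" for x using B(2) b that coord_spaceD by blast
    ultimately show "mat_op A (\<lambda>x y. w x y / D x) b = d b *\<^sub>R b"
      by (auto simp: mat_op_def vec_eq_iff)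
  qed
  also have "mset_set B = add_mset c (mset_set (B - {c}))"
    using mset_set.remove[OF B(1) c(1)] .
  finally have sp: "spectrum_on A (\<lambda>x y. w x y / D x) = add_mset (d c) (image_mset d (mset_set (B - {c})))"
    by simp
  have dl: "d b \<le> l2" if "b \<in> B" "b \<noteq> c" for b
    unfolding l2_def by (rule lambda2_add_mset[OF sp]) (use B(1) that d1 c in auto)
  show ?thesis
  \<comment> \<open>If \<open>l2\<close> is at least 1, the bound by the top eigenvalue suffices.
    Otherwise 1 is attained only at \<open>c\<close>, and it remains to see that \<open>f\<close>
    has no component along \<open>c\<close>.\<close>
  proof (cases "l2 \<ge> 1")
    case True
    have "0 \<le> (\<Sum>x\<in>A. D x * (f $ x)\<^sup>2)" using D(2) by (intro sum_nonneg) (simp add: less_imp_le)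
    then have "1 * (\<Sum>x\<in>A. D x * (f $ x)\<^sup>2) \<le> l2 * (\<Sum>x\<in>A. D x * (f $ x)\<^sup>2)"
      using True by (intro mult_right_mono) auto
    then show ?thesis using le[of f] by (simp add: l2_def)
  next
    case False
    define J where "J b = (\<Sum>x\<in>A. D x * f $ x * b $ x)" for b
    have Ib: "I b = 0" if "b \<in> B" "b \<noteq> c" for b
      using I0[OF that(1)] dl[OF that] False by auto
    have rest: "(\<Sum>b\<in>B. I b * g b) = I c * g c" for g
      using Ib by (subst sum.remove[OF B(1) c(1)]) auto
    have "(\<Sum>x\<in>A. D x) = (I c)\<^sup>2" using nmI rest[of I] by (simp add: power2_eq_square)
    then have Ic: "I c \<noteq> 0" using Dpos by auto
    \<comment> \<open>Parseval for \<open>1 + f\<close>, compared with Parseval for 1 and for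
      \<open>f\<close>, yields the mixed identity: the weighted mean of \<open>f\<close>, which is
      0, equals \<open>I c * J c\<close>.\<close>
    have "(\<Sum>x\<in>A. D x * (1 + f $ x)\<^sup>2) = (\<Sum>b\<in>B. (I b + J b)\<^sup>2)"
      using nm[of "\<chi> x. 1 + f $ x"] by (simp add: I_def J_def algebra_simps sum.distrib)
    moreover have "(\<Sum>x\<in>A. D x * (1 + f $ x)\<^sup>2) = (\<Sum>x\<in>A. D x) + 2 * (\<Sum>x\<in>A. D x * f $ x) + (\<Sum>x\<in>A. D x * (f $ x)\<^sup>2)"
      by (simp add: power2_eq_square algebra_simps sum.distrib sum_distrib_left)
    moreover have "(\<Sum>b\<in>B. (I b + J b)\<^sup>2) = (\<Sum>b\<in>B. (I b)\<^sup>2) + 2 * (\<Sum>b\<in>B. I b * J b) + (\<Sum>b\<in>B. (J b)\<^sup>2)"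
      by (simp add: power2_eq_square algebra_simps sum.distrib sum_distrib_left)
    ultimately have "I c * J c = 0"
      using f nmI nm[of f] rest[of J] by (simp add: J_def)
    then have Jc: "J c = 0" using Ic by simp
    have "quad_form A w f = (\<Sum>b\<in>B. d b * (J b)\<^sup>2)" by (simp add: qf J_def)
    also have "\<dots> \<le> (\<Sum>b\<in>B. l2 * (J b)\<^sup>2)"
    proof (rule sum_mono)
      fix b assume "b \<in> B"
      then show "d b * (J b)\<^sup>2 \<le> l2 * (J b)\<^sup>2"
        using dl[of b] Jc by (cases "b = c") (auto intro: mult_right_mono)
    qed
    also have "\<dots> = l2 * (\<Sum>x\<in>A. D x * (f $ x)\<^sup>2)"
      using nm[of f] by (simp add: J_def sum_distrib_left)
    finally show ?thesis by (simp add: l2_def)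
  qed
qed

text \<open>
  A mean-zero vector on one side of a bipartite graph can be paired with a centred vector on the
  other side; rescaling the two sides against each other turns the bound \<open>\<lambda>\<^sub>2\<close> into
  \<open>\<alpha>\<close> and \<open>\<beta>\<close>.
\<close>

lemma bipartite_form_le:
  fixes w :: "'x::finite \<Rightarrow> 'x \<Rightarrow> real"
  assumes sym: "\<And>x y. x \<in> A \<Longrightarrow> y \<in> A \<Longrightarrow> w x y = w y x"
    and nonneg: "\<And>x y. x \<in> A \<Longrightarrow> y \<in> A \<Longrightarrow> w x y \<ge> 0"
    and D: "\<And>x. x \<in> A \<Longrightarrow> D x = (\<Sum>y\<in>A. w x y)" "\<And>x. x \<in> A \<Longrightarrow> D x > 0"
    and card: "card A \<ge> 2"
    and bip: "\<And>x y. x \<in> A \<Longrightarrow> y \<in> A \<Longrightarrow> g x = g y \<Longrightarrow> w x y = 0"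
    and ab: "\<alpha> \<ge> 0" "\<beta> \<ge> 0"
    and l2: "lambda2 A (\<lambda>x y. w x y / D x) \<le> sqrt (\<alpha> * \<beta>)"
    and a: "(\<Sum>x\<in>A. if g x then 0 else D x * a $ x) = 0"
  shows "quad_form A w a \<le> (\<Sum>x\<in>A. (if g x then \<alpha> else \<beta>) * (D x * (a $ x)\<^sup>2))"
proof -
  define G where "G = (\<Sum>x\<in>A. if g x then D x else 0)"
  \<comment> \<open>The weighted mean of \<open>a\<close> on the side \<open>g\<close>. If that side
    is empty, then \<open>G = 0\<close> and division by zero gives \<open>m = 0\<close>.\<close>
  define m where "m = (\<Sum>x\<in>A. if g x then D x * a $ x else 0) / G"
  have D0: "D x \<ge> 0" if "x \<in> A" for x using D(2)[OF that] by simp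
  have G0: "G \<ge> 0" using D0 by (auto simp: G_def intro!: sum_nonneg)
  have mG: "m * G = (\<Sum>x\<in>A. if g x then D x * a $ x else 0)"
  proof (cases "G = 0")
    case True
    then have "\<forall>x\<in>A. (if g x then D x else 0) = 0"
      using D0 unfolding G_def by (subst (asm) sum_nonneg_eq_0_iff) auto
    then have "(\<Sum>x\<in>A. if g x then D x * a $ x else 0) = 0" using D(2) by (intro sum.neutral) force
    then show ?thesis using True by simp
  qed (simp add: m_def)
  define F1 F2 where "F1 = (\<Sum>x\<in>A. if g x then D x * (a $ x - m)\<^sup>2 else 0)"
    and "F2 = (\<Sum>x\<in>A. if g x then 0 else D x * (a $ x)\<^sup>2)"
  define E1 where "E1 = (\<Sum>x\<in>A. if g x then D x * (a $ x)\<^sup>2 else 0)"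
  have F0: "F1 \<ge> 0" "F2 \<ge> 0" using D0 by (auto simp: F1_def F2_def intro!: sum_nonneg mult_nonneg_nonneg)
  have "F1 = E1 - 2 * m * (\<Sum>x\<in>A. if g x then D x * a $ x else 0) + m\<^sup>2 * G"
    unfolding F1_def E1_def G_def sum_distrib_left sum_subtractf[symmetric] sum.distrib[symmetric]
    by (intro sum.cong) (auto simp: power2_eq_square algebra_simps)
  then have "F1 = E1 - m\<^sup>2 * G" by (simp add: mG[symmetric] power2_eq_square)
  then have F1E1: "F1 \<le> E1" using G0 by simp
  have key: "quad_form A w a \<le> lambda2 A (\<lambda>x y. w x y / D x) * (s\<^sup>2 * F1 + F2 / s\<^sup>2)" if s: "s > 0" for s :: real
  proof -
    \<comment> \<open>Centred on the side \<open>g\<close> and rescaled by \<open>s\<close> on one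
      side and \<open>1 / s\<close> on the other. Both sides then have mean zero, as
      \<open>lambda2_variational\<close> requires in total.\<close>
    define f :: "real ^ 'x" where "f = (\<chi> x. if g x then s * (a $ x - m) else a $ x / s)"
    have "(\<Sum>x\<in>A. D x * f $ x) = s * ((\<Sum>x\<in>A. if g x then D x * a $ x else 0) - m * G)
        + (\<Sum>x\<in>A. if g x then 0 else D x * a $ x) / s"
      unfolding G_def sum_distrib_left sum_divide_distrib sum_subtractf[symmetric] sum.distrib[symmetric] f_def
      by (intro sum.cong) (auto simp: algebra_simps)
    then have "(\<Sum>x\<in>A. D x * f $ x) = 0" using a mG by simp
    then have "quad_form A w f \<le> lambda2 A (\<lambda>x y. w x y / D x) * (\<Sum>x\<in>A. D x * (f $ x)\<^sup>2)"
      using lambda2_variational[of A w D f] sym nonneg D card by blast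
    moreover have "(\<Sum>x\<in>A. D x * (f $ x)\<^sup>2) = s\<^sup>2 * F1 + F2 / s\<^sup>2"
      unfolding F1_def F2_def sum_distrib_left sum_divide_distrib sum.distrib[symmetric] f_def
      by (intro sum.cong) (auto simp: power2_eq_square algebra_simps)
    \<comment> \<open>Each edge joins the two sides, so \<open>s\<close> and \<open>1 / s\<close>
      cancel. The terms with \<open>m\<close> add up to multiples of the weighted sum of
      \<open>a\<close> over the uncentred side, which vanishes by assumption.\<close>
    moreover have "quad_form A w f = quad_form A w a"
    proof -
      define h where "h x y = (if g x \<and> \<not> g y then w x y * a $ y else 0)" for x y
      have t: "w x y * f $ x * f $ y = w x y * a $ x * a $ y - m * h x y - m * h y x"
        if "x \<in> A" "y \<in> A" for x y
        using bip[OF that] sym[OF that] s by (auto simp: f_def h_def algebra_simps)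
      have "(\<Sum>x\<in>A. \<Sum>y\<in>A. h x y) = (\<Sum>y\<in>A. \<Sum>x\<in>A. h x y)" by (rule sum.swap)
      also have "\<dots> = (\<Sum>y\<in>A. if g y then 0 else D y * a $ y)"
      proof (rule sum.cong[OF refl])
        fix y assume y: "y \<in> A"
        have "(\<Sum>x\<in>A. h x y) = (\<Sum>x\<in>A. if g y then 0 else w y x * a $ y)"
          using bip[OF _ y] sym[OF y] by (intro sum.cong) (auto simp: h_def)
        then show "(\<Sum>x\<in>A. h x y) = (if g y then 0 else D y * a $ y)"
          using D(1)[OF y] by (simp add: sum_distrib_right)
      qed
      finally have h1: "(\<Sum>x\<in>A. \<Sum>y\<in>A. h x y) = 0" using a by simp
      have h2: "(\<Sum>x\<in>A. \<Sum>y\<in>A. h y x) = 0" using h1 by (subst sum.swap)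
      have "quad_form A w f = (\<Sum>x\<in>A. \<Sum>y\<in>A. w x y * a $ x * a $ y - m * h x y - m * h y x)"
        unfolding quad_form_def using t by (intro sum.cong refl) simp
      also have "\<dots> = quad_form A w a"
        unfolding sum_subtractf sum_distrib_left[symmetric] h1 h2 quad_form_def by simp
      finally show ?thesis .
    qed
    ultimately show ?thesis by simp
  qed
  have "quad_form A w a \<le> \<alpha> * F1 + \<beta> * F2"
  \<comment> \<open>In the degenerate case the optimal \<open>s\<close> does not exist, but the
    second eigenvalue is then nonpositive and \<open>s = 1\<close> already suffices.\<close>
  proof (cases "\<alpha> * \<beta> = 0")
    case True
    then have "lambda2 A (\<lambda>x y. w x y / D x) * (1\<^sup>2 * F1 + F2 / 1\<^sup>2) \<le> 0"
      using l2 F0 unfolding True by (simp add: mult_nonpos_nonneg)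
    then have "quad_form A w a \<le> 0" using key[of 1] by simp
    then show ?thesis using F0 ab by (smt (verit) mult_nonneg_nonneg)
  next
    case False
    then have pos: "\<alpha> > 0" "\<beta> > 0" using ab by auto
    \<comment> \<open>Chosen so that \<open>sqrt (\<alpha> * \<beta>)\<close> times the square of
      \<open>s\<close> is \<alpha>, and divided by that square is \<beta>.\<close>
    define s where "s = sqrt (sqrt (\<alpha> / \<beta>))"
    have s: "s > 0" "s\<^sup>2 = sqrt (\<alpha> / \<beta>)" using pos by (auto simp: s_def)
    have "quad_form A w a \<le> sqrt (\<alpha> * \<beta>) * (s\<^sup>2 * F1 + F2 / s\<^sup>2)"
      using key[OF s(1)] l2 F0 s(1)
      by (meson add_nonneg_nonneg divide_nonneg_nonneg mult_nonneg_nonneg mult_right_mono order_trans zero_le_power2)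
    also have "\<dots> = (sqrt (\<alpha> * \<beta>) * sqrt (\<alpha> / \<beta>)) * F1 + (sqrt (\<alpha> * \<beta>) / sqrt (\<alpha> / \<beta>)) * F2"
      by (simp add: s(2) algebra_simps)
    also have "sqrt (\<alpha> * \<beta>) * sqrt (\<alpha> / \<beta>) = \<alpha>"
      using pos by (simp add: real_sqrt_mult real_sqrt_divide)
    also have "sqrt (\<alpha> * \<beta>) / sqrt (\<alpha> / \<beta>) = \<beta>"
      using pos by (simp add: real_sqrt_mult real_sqrt_divide)
    finally show ?thesis .
  qed
  also have "\<dots> \<le> \<alpha> * E1 + \<beta> * F2" using F1E1 ab by (simp add: mult_left_mono)
  also have "\<dots> = (\<Sum>x\<in>A. (if g x then \<alpha> else \<beta>) * (D x * (a $ x)\<^sup>2))"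
    unfolding E1_def F2_def sum_distrib_left sum.distrib[symmetric] by (intro sum.cong) auto
  finally show ?thesis .
qed

text \<open>
  The trickle-down argument: by \<open>contr\<close> every eigenvalue \<open>l\<close> of \<open>D\<^sup>-\<^sup>1 M\<close> satisfies
  \<open>l \<le> l\<^sup>2\<close>, while by Perron-Frobenius \<open>1\<close> is the largest one and is simple. Hence the others are
  nonpositive.
\<close>

lemma trickle_down_form:
  fixes M :: "'x::finite \<Rightarrow> 'x \<Rightarrow> real"
  assumes sym: "\<And>x y. x \<in> A \<Longrightarrow> y \<in> A \<Longrightarrow> M x y = M y x"
    and off: "\<And>x y. x \<in> A \<Longrightarrow> y \<in> A \<Longrightarrow> x \<noteq> y \<Longrightarrow> M x y \<ge> 0"
    and conn: "\<And>x y. x \<in> A \<Longrightarrow> y \<in> A \<Longrightarrow> (x, y) \<in> {(x, y). x \<in> A \<and> y \<in> A \<and> x \<noteq> y \<and> M x y > 0}\<^sup>*"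
    and w: "\<And>x. x \<in> A \<Longrightarrow> w x > 0"
    and D: "\<And>x. x \<in> A \<Longrightarrow> D x > 0"
    and eigw: "\<And>x. x \<in> A \<Longrightarrow> (\<Sum>y\<in>A. M x y * w y) = D x * w x"
    and contr: "\<And>a. quad_form A M a \<le> (\<Sum>x\<in>A. (\<Sum>y\<in>A. M x y * a $ y)\<^sup>2 / D x)"
    and a: "(\<Sum>x\<in>A. D x * w x * a $ x) = 0"
  shows "quad_form A M a \<le> 0"
proof -
  have s: "\<forall>x\<in>A. \<forall>y\<in>A. M x y = M y x" and p: "\<forall>x\<in>A. D x > 0"
    using sym D by auto
  obtain B d where B: "finite B" "B \<subseteq> coord_space A" "independent B" "card B = card A"
    and eig: "\<forall>b\<in>B. \<forall>x\<in>A. (\<Sum>y\<in>A. M x y * b $ y) = d b * D x * b $ x"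
    and norm: "\<forall>b\<in>B. (\<Sum>x\<in>A. D x * (b $ x)\<^sup>2) = 1"
    and qf: "\<forall>a. quad_form A M a = (\<Sum>b\<in>B. d b * (\<Sum>x\<in>A. D x * a $ x * b $ x)\<^sup>2)"
    and nm: "\<forall>a. (\<Sum>x\<in>A. D x * (a $ x)\<^sup>2) = (\<Sum>b\<in>B. (\<Sum>x\<in>A. D x * a $ x * b $ x)\<^sup>2)"
    using weighted_eigenbasis[OF s p] by (elim exE conjE) (rule that; assumption)
  note eig = eig[rule_format] and norm = norm[rule_format] and qf = qf[rule_format] and nm = nm[rule_format]
  have "d b * (\<Sum>x\<in>A. D x * a $ x * b $ x)\<^sup>2 \<le> 0" if b: "b \<in> B" for b
  proof -
    have qb: "quad_form A M b = d b"
    proof -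
      have "quad_form A M b = (\<Sum>x\<in>A. b $ x * (\<Sum>y\<in>A. M x y * b $ y))"
        by (simp add: quad_form_def sum_distrib_left mult_ac)
      also have "\<dots> = d b * (\<Sum>x\<in>A. D x * (b $ x)\<^sup>2)"
        using eig[OF b] by (simp add: sum_distrib_left power2_eq_square mult_ac)
      finally show ?thesis using norm[OF b] by simp
    qed
    \<comment> \<open>On a normalized eigenvector the right-hand side of \<open>contr\<close> is the
      square of the eigenvalue.\<close>
    have "(\<Sum>x\<in>A. (\<Sum>y\<in>A. M x y * b $ y)\<^sup>2 / D x) = (\<Sum>x\<in>A. (d b)\<^sup>2 * (D x * (b $ x)\<^sup>2))"
    proof (rule sum.cong[OF refl])
      fix x assume x: "x \<in> A"
      show "(\<Sum>y\<in>A. M x y * b $ y)\<^sup>2 / D x = (d b)\<^sup>2 * (D x * (b $ x)\<^sup>2)"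
        unfolding eig[OF b x] using D[OF x] by (simp add: power2_eq_square)
    qed
    also have "\<dots> = (d b)\<^sup>2" by (simp add: sum_distrib_left[symmetric] norm[OF b])
    finally have sq: "d b \<le> (d b)\<^sup>2" using contr[of b] qb by simp
    have le1: "d b \<le> 1"
      using dirichlet_form_le(1)[of A M w D b] sym w eigw off qb norm[OF b] by metis
    show ?thesis
    proof (cases "d b = 1")
      case True
      \<comment> \<open>Equality in the Dirichlet bound propagates along edges, so an eigenvector
        for 1 is a multiple of \<open>w\<close>; its term is then killed by the assumption on
        \<open>a\<close>.\<close>
      have step: "b $ x / w x = b $ y / w y" if "x \<in> A" "y \<in> A" "x \<noteq> y" "M x y > 0" for x y
        using dirichlet_form_le(2)[of A M w D b x y] sym w eigw off qb norm[OF b] that True by metis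
      have const: "b $ x / w x = b $ y / w y" if "x \<in> A" "y \<in> A" for x y
        using conn[OF that]
      proof (induction rule: rtrancl_induct)
        case (step y z)
        then show ?case using \<open>\<And>x y. x \<in> A \<Longrightarrow> y \<in> A \<Longrightarrow> x \<noteq> y \<Longrightarrow> M x y > 0 \<Longrightarrow> b $ x / w x = b $ y / w y\<close>[of y z]
          by auto
      qed simp
      obtain k where k: "\<And>x. x \<in> A \<Longrightarrow> b $ x = k * w x"
      proof (cases "A = {}")
        case False
        then obtain z where z: "z \<in> A" by blast
        show ?thesis
          using that[of "b $ z / w z"] const[OF _ z] w by (metis less_irrefl nonzero_divide_eq_eq)
      qed (use that in auto)
      have "(\<Sum>x\<in>A. D x * a $ x * b $ x) = k * (\<Sum>x\<in>A. D x * w x * a $ x)"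
        unfolding sum_distrib_left using k by (intro sum.cong) auto
      then show ?thesis using a by simp
    next
      case False
      have "d b \<le> 0"
      proof (rule ccontr)
        assume "\<not> d b \<le> 0"
        then have "d b * d b < d b * 1" using False le1 by (intro mult_strict_left_mono) auto
        then show False using sq by (simp add: power2_eq_square)
      qed
      then show ?thesis by (simp add: mult_nonpos_nonneg)
    qed
  qed
  then show ?thesis unfolding qf by (rule sum_nonpos)
qed

text \<open>Subtracting the multiple of \<open>v\<close> that moves \<open>a\<close> into the
  hyperplane makes the form nonpositive. After multiplication by \<open>Q v v\<close> this is the
  claim plus a square, so the multiple need not be the optimal one.\<close>

lemma reversed_cauchy_schwarz:
  fixes Q :: "'a::real_inner \<Rightarrow> 'a \<Rightarrow> real"
  assumes Q: "bilinear Q" "\<And>a b. Q a b = Q b a"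
    and neg: "\<And>a. c \<bullet> a = 0 \<Longrightarrow> Q a a \<le> 0" and v: "Q v v > 0"
  shows "Q v v * Q a a \<le> (Q a v)\<^sup>2"
proof -
  have cv: "c \<bullet> v \<noteq> 0" using neg[of v] v by auto
  define r where "r = (c \<bullet> a) / (c \<bullet> v)"
  have "c \<bullet> (a - r *\<^sub>R v) = 0" using cv by (simp add: r_def inner_diff_right)
  then have "Q (a - r *\<^sub>R v) (a - r *\<^sub>R v) \<le> 0" by (rule neg)
  also have "Q (a - r *\<^sub>R v) (a - r *\<^sub>R v) = Q a a - 2 * r * Q a v + r\<^sup>2 * Q v v"
    using Q(2)[of v a]
    by (simp add: bilinear_lsub[OF Q(1)] bilinear_rsub[OF Q(1)] bilinear_lmul[OF Q(1)] bilinear_rmul[OF Q(1)]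
        algebra_simps power2_eq_square)
  finally have "Q v v * (Q a a - 2 * r * Q a v + r\<^sup>2 * Q v v) \<le> 0"
    using v by (simp add: mult_nonneg_nonpos)
  moreover have "Q v v * (Q a a - 2 * r * Q a v + r\<^sup>2 * Q v v)
      = Q v v * Q a a - (Q a v)\<^sup>2 + (Q a v - r * Q v v)\<^sup>2"
    by (simp add: power2_eq_square algebra_simps)
  ultimately show ?thesis by (smt (verit) zero_le_power2)
qed

section \<open>Hitting sums of absorbing walks\<close>

definition walk_prod :: "('v \<Rightarrow> 'v \<Rightarrow> real) \<Rightarrow> 'v list \<Rightarrow> real" where
  "walk_prod W xs = (\<Prod>i<length xs - 1. W (xs ! i) (xs ! Suc i))"

lemma walk_prod_Cons: "xs \<noteq> [] \<Longrightarrow> walk_prod W (s # xs) = W s (hd xs) * walk_prod W xs"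
proof -
  assume "xs \<noteq> []"
  then obtain n where n: "length xs = Suc n" by (cases xs) auto
  have "walk_prod W (s # xs) = (\<Prod>i<Suc n. W ((s # xs) ! i) (xs ! i))" by (simp add: walk_prod_def n)
  also have "\<dots> = W s (xs ! 0) * (\<Prod>i<n. W (xs ! i) (xs ! Suc i))"
    by (subst prod.lessThan_Suc_shift) simp
  finally show ?thesis using \<open>xs \<noteq> []\<close> by (simp add: walk_prod_def n hd_conv_nth)
qed

lemma walk_sum_eq: "walk_sum V B W U u v = (\<Sum>\<^sub>\<infinity>xs\<in>walks V B U u v. walk_prod W xs)"
  by (simp add: walk_sum_def walk_prod_def)

locale absorbing =
  fixes V B :: "'v set" and W :: "'v \<Rightarrow> 'v \<Rightarrow> real"
  assumes absorbing: "absorbing_walk V B W"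
begin

lemma finite_states: "finite V" "finite B" and disjoint_states: "V \<inter> B = {}"
  and W_nonneg: "u \<in> V \<union> B \<Longrightarrow> v \<in> V \<union> B \<Longrightarrow> W u v \<ge> 0"
  and W_stochastic: "u \<in> V \<union> B \<Longrightarrow> (\<Sum>v\<in>V \<union> B. W u v) = 1"
  and W_absorbed: "v \<in> V \<Longrightarrow> \<exists>b\<in>B. (v, b) \<in> {(x, y). x \<in> V \<union> B \<and> y \<in> V \<union> B \<and> W x y > 0}\<^sup>*"
  using absorbing by (auto simp: absorbing_walk_def)

text \<open>First-step decomposition. As \<open>s\<close> lies outside \<open>U\<close> and
  \<open>u\<close> inside, the one-point walk does not occur, and a second vertex that is not the
  last one must be in \<open>V - U\<close>.\<close>

lemma walks_Cons:
  assumes "s \<in> V" "s \<notin> U" "u \<in> U" "u \<in> V"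
  shows "walks V B U s u = insert [s, u] (\<Union>r\<in>V - U. (#) s ` walks V B U r u)"
proof (intro equalityI subsetI)
  fix xs assume xs: "xs \<in> walks V B U s u"
  then obtain ys where ys: "xs = s # ys" by (cases xs) (auto simp: walks_def)
  have "ys \<noteq> []" using xs ys assms by (auto simp: walks_def)
  then obtain r zs where zs: "ys = r # zs" by (cases ys) auto
  show "xs \<in> insert [s, u] (\<Union>r\<in>V - U. (#) s ` walks V B U r u)"
  proof (cases "zs = []")
    case True then show ?thesis using xs ys zs by (auto simp: walks_def)
  next
    case False
    have int: "xs ! i \<notin> B \<union> U" if "0 < i" "i < length xs - 1" for i
      using xs that by (auto simp: walks_def)
    have "r \<notin> B \<union> U" using int[of 1] ys zs False by auto
    moreover have "r \<in> V \<union> B" using xs ys zs by (auto simp: walks_def)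
    moreover have "ys \<in> walks V B U r u"
    proof -
      have "ys ! i \<notin> B \<union> U" if "0 < i" "i < length ys - 1" for i
        using int[of "Suc i"] that ys by auto
      then show ?thesis using xs ys zs by (auto simp: walks_def)
    qed
    ultimately show ?thesis using ys by auto
  qed
next
  fix xs assume "xs \<in> insert [s, u] (\<Union>r\<in>V - U. (#) s ` walks V B U r u)"
  then show "xs \<in> walks V B U s u"
  proof
    assume "xs = [s, u]" then show ?thesis using assms by (auto simp: walks_def)
  next
    assume "xs \<in> (\<Union>r\<in>V - U. (#) s ` walks V B U r u)"
    then obtain r ys where r: "r \<in> V" "r \<notin> U" "ys \<in> walks V B U r u" "xs = s # ys" by blast
    have "xs ! i \<notin> B \<union> U" if i: "0 < i" "i < length xs - 1" for i
    proof (cases i)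
      case (Suc j)
      show ?thesis
      proof (cases j)
        case 0
        have "ys ! 0 = r" using r(3) by (auto simp: walks_def hd_conv_nth)
        then show ?thesis using 0 Suc r disjoint_states by auto
      next
        case (Suc k)
        then show ?thesis using r(3,4) i \<open>i = Suc j\<close> by (auto simp: walks_def)
      qed
    qed (use i in simp)
    then show ?thesis using r assms by (auto simp: walks_def)
  qed
qed

lemma walk_prod_nonneg: "set xs \<subseteq> V \<union> B \<Longrightarrow> walk_prod W xs \<ge> 0"
  unfolding walk_prod_def by (intro prod_nonneg ballI W_nonneg) (auto simp: subset_iff)

lemma walks_states: "xs \<in> walks V B U s u \<Longrightarrow> set xs \<subseteq> V \<union> B"
  by (simp add: walks_def)

lemma walk_prod_walks_nonneg: "xs \<in> walks V B U s u \<Longrightarrow> walk_prod W xs \<ge> 0"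
  by (rule walk_prod_nonneg[OF walks_states])

lemma finite_short_walks: "finite {xs \<in> walks V B U s u. length xs \<le> n}"
  by (rule finite_subset[OF _ finite_lists_length_le[of "V \<union> B" n]])
    (use finite_states in \<open>auto simp: walks_def\<close>)

text \<open>The sum is the probability of entering \<open>B \<union> U\<close> for the first time at
  \<open>u\<close> within \<open>n - 1\<close> steps. The induction follows the first step and needs
  only that the rows of \<open>W\<close> sum to 1. This bound gives convergence of the hitting
  sums.\<close>

lemma short_walks_le_1:
  assumes "s \<in> V" "s \<notin> U" "u \<in> U" "u \<in> V"
  shows "(\<Sum>xs | xs \<in> walks V B U s u \<and> length xs \<le> n. walk_prod W xs) \<le> 1"
  using assms
proof (induction n arbitrary: s)
  case 0
  then have "{xs. xs \<in> walks V B U s u \<and> length xs \<le> 0} = {}" by (auto simp: walks_def)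
  then show ?case by (simp only: sum.empty)
next
  case (Suc n)
  let ?F = "\<lambda>r. {xs. xs \<in> walks V B U r u \<and> length xs \<le> n}"
  have sub: "{xs. xs \<in> walks V B U s u \<and> length xs \<le> Suc n} \<subseteq> insert [s, u] (\<Union>r\<in>V - U. (#) s ` ?F r)"
    unfolding walks_Cons[OF Suc.prems] by auto
  have step: "(\<Sum>xs\<in>(#) s ` ?F r. walk_prod W xs) = W s r * (\<Sum>xs\<in>?F r. walk_prod W xs)" for r
  proof -
    have "(\<Sum>xs\<in>(#) s ` ?F r. walk_prod W xs) = (\<Sum>xs\<in>?F r. walk_prod W (s # xs))"
      by (simp add: sum.reindex)
    also have "\<dots> = (\<Sum>xs\<in>?F r. W s r * walk_prod W xs)"
      by (intro sum.cong refl) (auto simp: walks_def walk_prod_Cons)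
    finally show ?thesis by (simp add: sum_distrib_left)
  qed
  have nn: "walk_prod W xs \<ge> 0" if "xs \<in> insert [s, u] (\<Union>r\<in>V - U. (#) s ` ?F r)" for xs
    using that Suc.prems walks_states by (intro walk_prod_nonneg) fastforce
  have "(\<Sum>xs | xs \<in> walks V B U s u \<and> length xs \<le> Suc n. walk_prod W xs)
      \<le> (\<Sum>xs\<in>insert [s, u] (\<Union>r\<in>V - U. (#) s ` ?F r). walk_prod W xs)"
    using finite_states finite_short_walks by (intro sum_mono2 sub nn) auto
  also have "\<dots> \<le> walk_prod W [s, u] + (\<Sum>xs\<in>(\<Union>r\<in>V - U. (#) s ` ?F r). walk_prod W xs)"
    using finite_states finite_short_walks nn by (subst sum.insert_if) auto
  also have "(\<Sum>xs\<in>(\<Union>r\<in>V - U. (#) s ` ?F r). walk_prod W xs)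
      = (\<Sum>r\<in>V - U. \<Sum>xs\<in>(#) s ` ?F r. walk_prod W xs)"
    using finite_states finite_short_walks by (intro sum.UNION_disjoint) (auto simp: walks_def)
  also have "\<dots> = (\<Sum>r\<in>V - U. W s r * (\<Sum>xs\<in>?F r. walk_prod W xs))"
    using step by simp
  also have "\<dots> \<le> (\<Sum>r\<in>V - U. W s r * 1)"
    using Suc by (intro sum_mono mult_left_mono W_nonneg) auto
  also have "walk_prod W [s, u] = W s u" by (simp add: walk_prod_def)
  also have "W s u + (\<Sum>r\<in>V - U. W s r * 1) = (\<Sum>r\<in>insert u (V - U). W s r)"
    using finite_states Suc.prems by simp
  also have "\<dots> \<le> (\<Sum>r\<in>V \<union> B. W s r)"
    using finite_states Suc.prems by (intro sum_mono2 W_nonneg) auto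
  also have "\<dots> = 1" using Suc.prems by (intro W_stochastic) auto
  finally show ?case by simp
qed

lemma walk_prod_summable:
  assumes "s \<in> V" "s \<notin> U" "u \<in> U" "u \<in> V"
  shows "walk_prod W summable_on walks V B U s u"
proof (rule nonneg_bdd_above_summable_on)
  show "0 \<le> walk_prod W xs" if "xs \<in> walks V B U s u" for xs
    using that walks_states walk_prod_nonneg by blast
  show "bdd_above (sum (walk_prod W) ` {F. F \<subseteq> walks V B U s u \<and> finite F})"
  proof (intro bdd_aboveI[where M = 1], clarify)
    fix F assume F: "F \<subseteq> walks V B U s u" "finite F"
    have "sum (walk_prod W) F \<le> (\<Sum>xs | xs \<in> walks V B U s u \<and> length xs \<le> Max (length ` F). walk_prod W xs)"
      using F finite_short_walks[of U s u "Max (length ` F)"]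
      by (intro sum_mono2) (auto intro: walk_prod_walks_nonneg)
    then show "sum (walk_prod W) F \<le> 1" using short_walks_le_1[OF assms] order_trans by blast
  qed
qed

text \<open>Apart from the lower bound \<open>walk_sum_ge\<close>, everything proved later about
  hitting sums is deduced from this finite linear equation and not from the series.\<close>

lemma walk_sum_step:
  assumes "s \<in> V" "s \<notin> U" "u \<in> U" "u \<in> V"
  shows "walk_sum V B W U s u = W s u + (\<Sum>r\<in>V - U. W s r * walk_sum V B W U r u)"
proof -
  have hs: "((\<lambda>xs. walk_prod W xs) has_sum W s r * walk_sum V B W U r u) ((#) s ` walks V B U r u)"
    if r: "r \<in> V - U" for r
  proof -
    have "(walk_prod W has_sum walk_sum V B W U r u) (walks V B U r u)"
      unfolding walk_sum_eq using walk_prod_summable r assms by (intro has_sum_infsum) auto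
    then have "((\<lambda>xs. W s r * walk_prod W xs) has_sum W s r * walk_sum V B W U r u) (walks V B U r u)"
      by (rule has_sum_cmult_right)
    then have "((\<lambda>xs. walk_prod W (s # xs)) has_sum W s r * walk_sum V B W U r u) (walks V B U r u)"
      by (rule has_sum_cong[THEN iffD1, rotated]) (auto simp: walks_def walk_prod_Cons)
    then show ?thesis by (subst has_sum_reindex) (auto simp: comp_def)
  qed
  have "(walk_prod W has_sum (\<Sum>r\<in>V - U. W s r * walk_sum V B W U r u)) (\<Union>r\<in>V - U. (#) s ` walks V B U r u)"
    using finite_states hs by (intro sum_has_sum) (auto simp: walks_def)
  then have "(walk_prod W has_sum (walk_prod W [s, u] + (\<Sum>r\<in>V - U. W s r * walk_sum V B W U r u)))
      (insert [s, u] (\<Union>r\<in>V - U. (#) s ` walks V B U r u))"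
    using assms by (intro has_sum_insert) (auto simp: walks_def)
  then have "infsum (walk_prod W) (walks V B U s u) = walk_prod W [s, u] + (\<Sum>r\<in>V - U. W s r * walk_sum V B W U r u)"
    unfolding walks_Cons[OF assms] by (rule infsumI)
  then show ?thesis by (simp add: walk_sum_eq[symmetric]) (simp add: walk_prod_def)
qed

lemma walk_sum_ge:
  assumes "s \<in> V" "s \<notin> U" "u \<in> U" "u \<in> V"
  shows "W s u \<le> walk_sum V B W U s u"
proof -
  have "(\<Sum>\<^sub>\<infinity>xs\<in>{[s, u]}. walk_prod W xs) \<le> walk_sum V B W U s u"
    unfolding walk_sum_eq
  proof (rule infsum_mono_neutral[OF _ walk_prod_summable[OF assms]])
    show "walk_prod W xs \<le> 0" if "xs \<in> {[s, u]} - walks V B U s u" for xs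
      using that assms by (auto simp: walks_def)
  qed (auto intro: walk_prod_walks_nonneg)
  then show ?thesis by (simp add: walk_prod_def)
qed

section \<open>Superharmonic functions and the first-passage identity\<close>

definition superharmonic :: "'v set \<Rightarrow> ('v \<Rightarrow> real) \<Rightarrow> bool" where
  "superharmonic U f \<longleftrightarrow> (\<forall>s\<in>V - U. f s > (\<Sum>r\<in>V - U. W s r * f r))"

text \<open>Minimum principle: at a minimum with value at most 0, row sums at most 1 would make the
  average at least that value, against strictness.\<close>

lemma superharmonic_pos:
  assumes "superharmonic U f" "s \<in> V - U"
  shows "f s > 0"
proof -
  have fin: "finite (V - U)" using finite_states by simp
  obtain m where m: "m \<in> V - U" "\<And>r. r \<in> V - U \<Longrightarrow> f m \<le> f r"
    using finite_has_minimal2[of "f ` (V - U)" "f s"] fin assms(2)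
    by (metis (no_types, lifting) arg_min_if_finite(1) arg_min_least empty_iff)
  have "f m > 0"
  proof (rule ccontr)
    assume "\<not> f m > 0"
    then have le: "f m \<le> 0" by simp
    have sub: "(\<Sum>r\<in>V - U. W m r) \<le> 1"
    proof -
      have "(\<Sum>r\<in>V - U. W m r) \<le> (\<Sum>r\<in>V \<union> B. W m r)"
        using finite_states m(1) by (intro sum_mono2 W_nonneg) auto
      then show ?thesis using W_stochastic[of m] m(1) by simp
    qed
    have "f m \<le> (\<Sum>r\<in>V - U. W m r) * f m" using mult_right_mono_neg[OF sub le] by simp
    also have "\<dots> = (\<Sum>r\<in>V - U. W m r * f m)" by (simp add: sum_distrib_right)
    also have "\<dots> \<le> (\<Sum>r\<in>V - U. W m r * f r)"
      using m by (intro sum_mono mult_left_mono W_nonneg) auto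
    also have "\<dots> < f m" using assms(1) m(1) by (simp add: superharmonic_def)
    finally show False by simp
  qed
  then show ?thesis using m(2)[OF assms(2)] by simp
qed

text \<open>Gaussian elimination of the state \<open>u\<close>: by the one-step equation of the
  hitting sums, the defect of the new function at \<open>s\<close> is exactly the old one. On
  vectors that depend only on the site this is what \<open>proj\<close> does.\<close>

lemma superharmonic_eliminate:
  assumes f: "superharmonic U f" and u: "u \<in> V" "u \<notin> U"
  shows "superharmonic (insert u U) (\<lambda>s. f s - walk_sum V B W (insert u U) s u * f u)"
  unfolding superharmonic_def
proof
  fix s assume s: "s \<in> V - insert u U"
  let ?T = "V - insert u U" and ?h = "\<lambda>s. walk_sum V B W (insert u U) s u"
  have hs: "?h s = W s u + (\<Sum>r\<in>?T. W s r * ?h r)"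
    by (rule walk_sum_step) (use s u in auto)
  have "(\<Sum>r\<in>?T. W s r * (f r - ?h r * f u)) = (\<Sum>r\<in>?T. W s r * f r) - (\<Sum>r\<in>?T. W s r * ?h r) * f u"
    by (simp add: right_diff_distrib sum_subtractf sum_distrib_right mult.assoc)
  also have "(\<Sum>r\<in>?T. W s r * ?h r) = ?h s - W s u" using hs by simp
  also have "(\<Sum>r\<in>?T. W s r * f r) - (?h s - W s u) * f u = (\<Sum>r\<in>insert u ?T. W s r * f r) - ?h s * f u"
    using finite_states by (simp add: algebra_simps)
  also have "insert u ?T = V - U" using u by auto
  also have "(\<Sum>r\<in>V - U. W s r * f r) - ?h s * f u < f s - ?h s * f u"
    using f s by (auto simp: superharmonic_def)
  finally show "(\<Sum>r\<in>?T. W s r * (f r - ?h r * f u)) < f s - ?h s * f u" .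
qed

text \<open>
  The witness is \<open>1 - \<delta>\<^sup>k\<close>, where \<open>k\<close> is the distance to \<open>B\<close> and \<open>\<delta>\<close> is smaller than all
  positive transition probabilities.
\<close>

lemma superharmonic_exists: "\<exists>f. superharmonic {} f"
proof -
  let ?R = "{(x, y). x \<in> V \<union> B \<and> y \<in> V \<union> B \<and> W x y > 0}"
  define k where "k v = (LEAST n. \<exists>b\<in>B. (v, b) \<in> ?R ^^ n)" for v
  have ex: "\<exists>n. \<exists>b\<in>B. (v, b) \<in> ?R ^^ n" if "v \<in> V" for v
    using W_absorbed[OF that] rtrancl_imp_relpow by fast
  have k0: "k b = 0" if "b \<in> B" for b
    unfolding k_def using that by (intro Least_eq_0) auto
  have step: "\<exists>r\<in>V \<union> B. W v r > 0 \<and> k v = Suc (k r)" if v: "v \<in> V" for v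
  proof -
    obtain b where b: "b \<in> B" "(v, b) \<in> ?R ^^ k v"
      using LeastI_ex[OF ex[OF v]] unfolding k_def by blast
    have "k v \<noteq> 0"
    proof
      assume "k v = 0"
      then have "v = b" using b(2) by simp
      then show False using b(1) v disjoint_states by auto
    qed
    then obtain n where n: "k v = Suc n" by (cases "k v") auto
    obtain r where r: "(v, r) \<in> ?R" "(r, b) \<in> ?R ^^ n" using b(2) unfolding n by (meson relpow_Suc_E2)
    have "k r \<le> n" unfolding k_def by (rule Least_le) (use r(2) b(1) in blast)
    moreover have "k v \<le> Suc (k r)"
    proof -
      have "\<exists>n. \<exists>b\<in>B. (r, b) \<in> ?R ^^ n" using r(2) b(1) by (intro exI[of _ n] bexI[of _ b])
      then have "\<exists>b\<in>B. (r, b) \<in> ?R ^^ k r" unfolding k_def by (rule LeastI_ex)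
      then obtain b' where b': "b' \<in> B" "(r, b') \<in> ?R ^^ k r" by blast
      then have "\<exists>b\<in>B. (v, b) \<in> ?R ^^ Suc (k r)"
        by (intro bexI[of _ b'] relpow_Suc_I2[OF r(1)])
      then show ?thesis unfolding k_def[of v] by (rule Least_le)
    qed
    ultimately show ?thesis using n r(1) by (intro bexI[of _ r]) auto
  qed
  \<comment> \<open>The element 1 keeps the set nonempty, so its minimum makes sense; halving the
    minimum makes \<delta> strictly smaller than each positive transition probability.\<close>
  define P where "P = insert 1 ((\<lambda>(x, y). W x y) ` ?R)"
  have "finite ?R" by (rule finite_subset[of _ "(V \<union> B) \<times> (V \<union> B)"]) (use finite_states in auto)
  then have finP: "finite P" by (simp add: P_def)
  have posP: "Min P > 0" using finP by (subst Min_gr_iff) (auto simp: P_def)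
  define \<delta> where "\<delta> = Min P / 2"
  have d: "\<delta> > 0" using posP by (simp add: \<delta>_def)
  have dW: "\<delta> < W x y" if "(x, y) \<in> ?R" for x y
  proof -
    have "W x y \<in> P" using that by (force simp: P_def)
    then have "Min P \<le> W x y" using finP by simp
    then show ?thesis using posP by (simp add: \<delta>_def)
  qed
  define f where "f v = 1 - \<delta> ^ k v" for v
  have "superharmonic {} f"
    unfolding superharmonic_def
  proof
    fix s assume s: "s \<in> V - {}"
    obtain r where r: "r \<in> V \<union> B" "W s r > 0" "k s = Suc (k r)" using step[of s] s by blast
    have "(\<Sum>v\<in>V - {}. W s v * f v) = (\<Sum>v\<in>V \<union> B. W s v * f v)"
      using finite_states k0 by (intro sum.mono_neutral_left) (auto simp: f_def)
    also have "\<dots> = 1 - (\<Sum>v\<in>V \<union> B. W s v * \<delta> ^ k v)"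
      using W_stochastic[of s] s by (simp add: f_def right_diff_distrib sum_subtractf)
    also have "\<dots> \<le> 1 - W s r * \<delta> ^ k r"
    proof -
      have "W s r * \<delta> ^ k r \<le> (\<Sum>v\<in>V \<union> B. W s v * \<delta> ^ k v)"
        using finite_states r(1) d s by (intro member_le_sum mult_nonneg_nonneg W_nonneg) auto
      then show ?thesis by simp
    qed
    also have "\<dots> < 1 - \<delta> * \<delta> ^ k r"
      using dW[of s r] r s d by simp
    finally show "(\<Sum>v\<in>V - {}. W s v * f v) < f s" by (simp add: f_def r(3))
  qed
  then show ?thesis by blast
qed

lemma superharmonic_mono:
  assumes "superharmonic U f" "\<And>s. s \<in> V - U \<Longrightarrow> f s > 0" "U \<subseteq> U'"
  shows "superharmonic U' f"
  unfolding superharmonic_def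
proof
  fix s assume s: "s \<in> V - U'"
  have "(\<Sum>r\<in>V - U'. W s r * f r) \<le> (\<Sum>r\<in>V - U. W s r * f r)"
    using finite_states assms s by (intro sum_mono2 mult_nonneg_nonneg W_nonneg less_imp_le[OF assms(2)]) auto
  also have "\<dots> < f s" using assms s by (auto simp: superharmonic_def)
  finally show "(\<Sum>r\<in>V - U'. W s r * f r) < f s" .
qed

lemma superharmonic_exists': "\<exists>f. superharmonic U f"
proof -
  obtain f where f: "superharmonic {} f" using superharmonic_exists by blast
  have "superharmonic U f" by (rule superharmonic_mono[OF f superharmonic_pos[OF f]]) auto
  then show ?thesis by blast
qed

text \<open>Adding any real multiple of the harmonic \<open>g\<close> to a strictly superharmonic
  \<open>f\<close> keeps it strictly superharmonic, hence positive at \<open>s\<close>. A suitable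
  multiple would give the value 0 if \<open>g s\<close> were nonzero.\<close>

lemma harmonic_zero:
  assumes g: "\<And>s. s \<in> V - U \<Longrightarrow> g s = (\<Sum>r\<in>V - U. W s r * g r)" and s: "s \<in> V - U"
  shows "g s = 0"
proof -
  obtain f where f: "superharmonic U f" using superharmonic_exists' by blast
  have pos: "c * g s + f s > 0" for c
  proof -
    have "superharmonic U (\<lambda>s. c * g s + f s)"
      unfolding superharmonic_def
    proof
      fix s assume s: "s \<in> V - U"
      have "(\<Sum>r\<in>V - U. W s r * (c * g r + f r)) = c * (\<Sum>r\<in>V - U. W s r * g r) + (\<Sum>r\<in>V - U. W s r * f r)"
        by (simp add: distrib_left sum.distrib sum_distrib_left mult_ac)
      also have "(\<Sum>r\<in>V - U. W s r * g r) = g s" using g[OF s] by simp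
      also have "(\<Sum>r\<in>V - U. W s r * f r) < f s" using f s by (simp add: superharmonic_def)
      finally show "(\<Sum>r\<in>V - U. W s r * (c * g r + f r)) < c * g s + f s" by simp
    qed
    then show ?thesis using superharmonic_pos s by blast
  qed
  show ?thesis
  proof (rule ccontr)
    assume "g s \<noteq> 0"
    then show False using pos[of "- f s / g s"] by simp
  qed
qed

text \<open>Decomposition of a walk at its first visit to \<open>v\<close>.\<close>

lemma walk_sum_first_visit:
  assumes u: "u \<in> V" "u \<in> U" and v: "v \<in> V" "v \<notin> U" and s: "s \<in> V - insert v U"
  shows "walk_sum V B W U s u = walk_sum V B W (insert v U) s u
    + walk_sum V B W (insert v U) s v * walk_sum V B W U v u"
proof -
  let ?h = "\<lambda>s. walk_sum V B W U s u" and ?a = "\<lambda>s. walk_sum V B W (insert v U) s u"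
    and ?b = "\<lambda>s. walk_sum V B W (insert v U) s v"
  let ?T = "V - insert v U"
  \<comment> \<open>Instead of splitting the series, the difference of both sides is shown to be
    harmonic off \<open>insert v U\<close>: the three one-step equations cancel their source
    terms.\<close>
  define g where "g s = ?h s - ?a s - ?b s * ?h v" for s
  have "g s = 0"
  proof (rule harmonic_zero[OF _ s])
    fix s assume s: "s \<in> ?T"
    have "?h s = W s u + (\<Sum>r\<in>insert v ?T. W s r * ?h r)"
    proof -
      have e: "V - U = insert v ?T" using v by auto
      have "?h s = W s u + (\<Sum>r\<in>V - U. W s r * ?h r)"
        by (rule walk_sum_step) (use s u in auto)
      then show ?thesis unfolding e .
    qed
    then have 1: "?h s = W s u + W s v * ?h v + (\<Sum>r\<in>?T. W s r * ?h r)"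
      using finite_states by simp
    have 2: "?a s = W s u + (\<Sum>r\<in>?T. W s r * ?a r)"
      by (rule walk_sum_step) (use s u in auto)
    have 3: "?b s = W s v + (\<Sum>r\<in>?T. W s r * ?b r)"
      by (rule walk_sum_step) (use s v in auto)
    have "(\<Sum>r\<in>?T. W s r * g r) = (\<Sum>r\<in>?T. W s r * ?h r) - (\<Sum>r\<in>?T. W s r * ?a r) - (\<Sum>r\<in>?T. W s r * ?b r) * ?h v"
      by (simp add: g_def right_diff_distrib sum_subtractf sum_distrib_right mult.assoc)
    also have "\<dots> = (?h s - W s u - W s v * ?h v) - (?a s - W s u) - (?b s - W s v) * ?h v"
      using 1 2 3 by simp
    also have "\<dots> = g s" by (simp add: g_def algebra_simps)
    finally show "g s = (\<Sum>r\<in>?T. W s r * g r)" by simp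
  qed
  then show ?thesis by (simp add: g_def)
qed

end

section \<open>Faces and projections\<close>

locale walk_complex = absorbing V B W for V B :: "'v set" and W +
  fixes d :: nat and S :: "'v \<Rightarrow> ('x::finite) set" and X :: "'x set set" and \<mu> :: "'x set \<Rightarrow> real"
  assumes partite: "partite_complex d V S X \<mu>"
begin

abbreviation "link_verts \<equiv> link_vertices X"
abbreviation "st \<equiv> site V S"
abbreviation "sts \<equiv> sites V S"
abbreviation "\<pi> \<equiv> proj V S X B W"
abbreviation "\<pi>s \<equiv> proj_list V S X B W"
abbreviation "LC \<equiv> link_cone V S X B W"
abbreviation "hit \<sigma> x y \<equiv> walk_sum V B W (insert (st x) (sts \<sigma>)) (st y) (st x)"

lemma face_subset: "\<sigma> \<in> X \<Longrightarrow> \<tau> \<subseteq> \<sigma> \<Longrightarrow> \<tau> \<in> X"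
  and card_V: "card V = d"
  and facet_pos: "\<omega> \<in> facets X \<Longrightarrow> \<mu> \<omega> > 0"
  and face_spins: "\<sigma> \<in> X \<Longrightarrow> \<sigma> \<subseteq> (\<Union>v\<in>V. S v)"
  and facet_spin: "\<omega> \<in> facets X \<Longrightarrow> v \<in> V \<Longrightarrow> \<exists>!x. x \<in> \<omega> \<inter> S v"
  and disjoint_spins: "disjoint_family_on S V"
  using partite by (auto simp: partite_complex_def)

lemma mem_link: "\<sigma> \<in> X \<Longrightarrow> \<tau> \<in> link X \<sigma> \<longleftrightarrow> \<tau> \<inter> \<sigma> = {} \<and> \<sigma> \<union> \<tau> \<in> X"
proof
  assume "\<tau> \<in> link X \<sigma>"
  then obtain \<rho> where "\<rho> \<in> X" "\<sigma> \<subseteq> \<rho>" "\<tau> = \<rho> - \<sigma>" by (auto simp: link_def)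
  moreover from this have "\<sigma> \<union> \<tau> = \<rho>" by blast
  ultimately show "\<tau> \<inter> \<sigma> = {} \<and> \<sigma> \<union> \<tau> \<in> X" by auto
next
  assume "\<tau> \<inter> \<sigma> = {} \<and> \<sigma> \<union> \<tau> \<in> X"
  moreover from this have "\<tau> = (\<sigma> \<union> \<tau>) - \<sigma>" by blast
  ultimately show "\<tau> \<in> link X \<sigma>" unfolding link_def by blast
qed

lemma mem_link_vertices: "\<sigma> \<in> X \<Longrightarrow> x \<in> link_verts \<sigma> \<longleftrightarrow> x \<notin> \<sigma> \<and> insert x \<sigma> \<in> X"
  by (simp add: link_vertices_def mem_link)

lemma link_vertices_insert:
  assumes "\<sigma> \<in> X" "x \<in> link_verts \<sigma>" "y \<in> link_verts (insert x \<sigma>)"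
  shows "y \<in> link_verts \<sigma>" "x \<in> link_verts (insert y \<sigma>)" "x \<noteq> y"
    "insert x \<sigma> \<in> X" "insert y \<sigma> \<in> X" "insert y (insert x \<sigma>) \<in> X"
proof -
  show 1: "insert x \<sigma> \<in> X" using assms mem_link_vertices by blast
  show 2: "insert y (insert x \<sigma>) \<in> X" using assms(3) mem_link_vertices[OF 1] by blast
  show 3: "insert y \<sigma> \<in> X" by (rule face_subset[OF 2]) auto
  show "x \<noteq> y" "y \<in> link_verts \<sigma>" "x \<in> link_verts (insert y \<sigma>)"
    using assms 1 2 3 mem_link_vertices by (auto simp: insert_commute)
qed

lemma face_in_facet: "\<sigma> \<in> X \<Longrightarrow> \<exists>\<omega>\<in>facets X. \<sigma> \<subseteq> \<omega>"
proof -
  assume "\<sigma> \<in> X"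
  then obtain \<omega> where "\<omega> \<in> X" "\<sigma> \<subseteq> \<omega>" "\<forall>\<rho>\<in>X. \<omega> \<subseteq> \<rho> \<longrightarrow> \<omega> = \<rho>"
    using finite_has_maximal2[of X \<sigma>] by auto
  then show ?thesis unfolding facets_def by auto
qed

lemma site_eq: "v \<in> V \<Longrightarrow> x \<in> S v \<Longrightarrow> st x = v"
  unfolding site_def using disjoint_spins by (intro the_equality) (auto simp: disjoint_family_on_def)

lemma site_of_face: "\<sigma> \<in> X \<Longrightarrow> x \<in> \<sigma> \<Longrightarrow> st x \<in> V \<and> x \<in> S (st x)"
  using face_spins site_eq by blast

lemma inj_on_site: "\<sigma> \<in> X \<Longrightarrow> inj_on st \<sigma>"
proof (rule inj_onI)
  fix x y assume a: "\<sigma> \<in> X" "x \<in> \<sigma>" "y \<in> \<sigma>" "st x = st y"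
  obtain \<omega> where "\<omega> \<in> facets X" "\<sigma> \<subseteq> \<omega>" using face_in_facet a by blast
  then have "\<exists>!z. z \<in> \<omega> \<inter> S (st x)" using facet_spin site_of_face[OF a(1,2)] by simp
  moreover have "x \<in> \<omega> \<inter> S (st x)" "y \<in> \<omega> \<inter> S (st x)"
    using site_of_face[OF a(1,2)] site_of_face[OF a(1,3)] a(2,3,4) \<open>\<sigma> \<subseteq> \<omega>\<close> by auto
  ultimately show "x = y" by blast
qed

lemma sites_eq: "\<sigma> \<in> X \<Longrightarrow> sts \<sigma> = st ` \<sigma>"
proof (intro equalityI subsetI)
  fix v assume "\<sigma> \<in> X" "v \<in> sts \<sigma>"
  then show "v \<in> st ` \<sigma>" using site_eq[of v] by (auto simp: sites_def)
next
  fix v assume "\<sigma> \<in> X" "v \<in> st ` \<sigma>"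
  then show "v \<in> sts \<sigma>" using site_of_face by (auto simp: sites_def)
qed

lemma sites_subset: "sts \<sigma> \<subseteq> V"
  by (auto simp: sites_def)

lemma card_sites: "\<sigma> \<in> X \<Longrightarrow> card (sts \<sigma>) = card \<sigma>"
  by (simp add: sites_eq card_image inj_on_site)

lemma card_face_le: "\<sigma> \<in> X \<Longrightarrow> card \<sigma> \<le> d"
  using card_facet[OF partite] card_nonfacet[OF partite] by (cases "\<sigma> \<in> facets X") force+

lemma facet_iff: "\<sigma> \<in> X \<Longrightarrow> \<sigma> \<in> facets X \<longleftrightarrow> card \<sigma> = d"
  using card_facet[OF partite] card_nonfacet[OF partite] by force

lemma link_vertex_site:
  assumes "\<sigma> \<in> X" "x \<in> link_verts \<sigma>"
  shows "st x \<in> V" "st x \<notin> sts \<sigma>" "sts (insert x \<sigma>) = insert (st x) (sts \<sigma>)"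
proof -
  have x: "x \<notin> \<sigma>" "insert x \<sigma> \<in> X" using assms mem_link_vertices by auto
  show "st x \<in> V" using site_of_face[OF x(2)] by simp
  show "sts (insert x \<sigma>) = insert (st x) (sts \<sigma>)" using sites_eq x(2) assms(1) by simp
  show "st x \<notin> sts \<sigma>"
    using inj_on_site[OF x(2)] x(1) unfolding sites_eq[OF assms(1)] by (auto simp: inj_on_def)
qed

lemma card_insert_link: "\<sigma> \<in> X \<Longrightarrow> x \<in> link_verts \<sigma> \<Longrightarrow> card (insert x \<sigma>) = Suc (card \<sigma>)"
  by (simp add: mem_link_vertices)

lemma link_vertices_nonempty: "\<sigma> \<in> X \<Longrightarrow> card \<sigma> < d \<Longrightarrow> link_verts \<sigma> \<noteq> {}"
proof -
  assume a: "\<sigma> \<in> X" "card \<sigma> < d"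
  obtain \<omega> where w: "\<omega> \<in> facets X" "\<sigma> \<subseteq> \<omega>" using face_in_facet a by blast
  have "\<omega> \<in> X" using w by (simp add: facets_def)
  have "\<sigma> \<noteq> \<omega>" using a(2) card_facet[OF partite w(1)] by auto
  then obtain x where "x \<in> \<omega>" "x \<notin> \<sigma>" using w(2) by blast
  then have "x \<in> link_verts \<sigma>" using face_subset[OF \<open>\<omega> \<in> X\<close>] w(2) a(1) by (simp add: mem_link_vertices)
  then show ?thesis by blast
qed

lemma proj_nth: "\<pi> \<sigma> x t $ y = (if y \<in> link_verts (insert x \<sigma>) then t $ y - hit \<sigma> x y * t $ x else 0)"
  by (simp add: proj_def)

lemma linear_proj: "linear (\<pi> \<sigma> x)"
  by (rule linearI) (auto simp: vec_eq_iff proj_nth algebra_simps)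

lemma linear_proj_list: "linear (\<pi>s \<sigma> xs)"
proof (induction xs arbitrary: \<sigma>)
  case Nil
  then show ?case by (simp add: linear_iff)
next
  case (Cons x xs)
  have e: "\<pi>s \<sigma> (x # xs) = \<pi>s (insert x \<sigma>) xs \<circ> \<pi> \<sigma> x" by (simp add: fun_eq_iff)
  show ?case unfolding e by (rule linear_compose[OF linear_proj Cons.IH])
qed

text \<open>Either composite subtracts from \<open>t $ z\<close> the hitting sums to both sites,
  each avoiding both sites, times \<open>t $ x\<close> and \<open>t $ y\<close>. First-visit
  decomposition at the second site gives this formula, which is symmetric in \<open>x\<close> and
  \<open>y\<close>.\<close>

lemma proj_commute:
  assumes \<sigma>: "\<sigma> \<in> X" and x: "x \<in> link_verts \<sigma>" and y: "y \<in> link_verts (insert x \<sigma>)"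
  shows "\<pi> (insert x \<sigma>) y (\<pi> \<sigma> x t) = \<pi> (insert y \<sigma>) x (\<pi> \<sigma> y t)"
proof -
  have nth: "\<pi> (insert x \<sigma>) y (\<pi> \<sigma> x t) $ z =
    (let U = insert (st x) (insert (st y) (sts \<sigma>)) in
      t $ z - walk_sum V B W U (st z) (st x) * t $ x - walk_sum V B W U (st z) (st y) * t $ y)"
    if x: "x \<in> link_verts \<sigma>" and y: "y \<in> link_verts (insert x \<sigma>)"
      and z: "z \<in> link_verts (insert y (insert x \<sigma>))" for x y z
  proof -
    note f = link_vertices_insert[OF \<sigma> x y]
    have z': "z \<in> link_verts (insert x \<sigma>)" using link_vertices_insert(1)[OF f(4) y z] .
    let ?U = "insert (st x) (sts \<sigma>)"
    have sx: "sts (insert x \<sigma>) = ?U" "st x \<in> V" using link_vertex_site[OF \<sigma> x] by auto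
    have sy: "st y \<in> V" "st y \<notin> ?U" using link_vertex_site[OF f(4) y] sx by auto
    have sz: "st z \<in> V - insert (st y) ?U"
      using link_vertex_site[OF f(6) z] link_vertex_site(3)[OF f(4) y] sx by auto
    have "walk_sum V B W ?U (st z) (st x) = walk_sum V B W (insert (st y) ?U) (st z) (st x)
      + walk_sum V B W (insert (st y) ?U) (st z) (st y) * walk_sum V B W ?U (st y) (st x)"
      by (rule walk_sum_first_visit) (use sx sy sz in auto)
    then show ?thesis
      using y z z' by (simp add: proj_nth sx Let_def insert_commute algebra_simps)
  qed
  show ?thesis
  proof (rule vec_eq_iff[THEN iffD2, rule_format])
    fix z
    note f = link_vertices_insert[OF \<sigma> x y]
    show "\<pi> (insert x \<sigma>) y (\<pi> \<sigma> x t) $ z = \<pi> (insert y \<sigma>) x (\<pi> \<sigma> y t) $ z"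
    proof (cases "z \<in> link_verts (insert y (insert x \<sigma>))")
      case True
      then show ?thesis
        unfolding nth[OF x y True] using nth[OF f(1,2)] by (simp add: insert_commute Let_def)
    next
      case False
      then show ?thesis by (simp add: proj_nth insert_commute)
    qed
  qed
qed

section \<open>The cones\<close>

lemma proj_in_coord_space: "\<pi> \<sigma> x t \<in> coord_space (link_verts (insert x \<sigma>))"
  by (simp add: coord_space_def proj_nth)

lemma mem_cone:
  assumes "\<sigma> \<in> X"
  shows "t \<in> LC \<sigma> \<longleftrightarrow> t \<in> coord_space (link_verts \<sigma>) \<and>
    (\<forall>xs. distinct xs \<and> set xs \<in> link X \<sigma> \<longrightarrow> (\<forall>y\<in>link_verts (\<sigma> \<union> set xs). \<pi>s \<sigma> xs t $ y > 0))"
proof -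
  have "{} \<in> link X \<sigma>" using assms by (simp add: mem_link)
  then have "(\<forall>y\<in>link_verts (\<sigma> \<union> set []). \<pi>s \<sigma> [] t $ y > 0)"
    if "\<forall>xs. distinct xs \<and> set xs \<in> link X \<sigma> \<longrightarrow> (\<forall>y\<in>link_verts (\<sigma> \<union> set xs). \<pi>s \<sigma> xs t $ y > 0)"
    using that by (metis distinct.simps(1) list.set(1))
  then show ?thesis unfolding link_cone_def by auto
qed

lemma cone_pos: "t \<in> LC \<sigma> \<Longrightarrow> x \<in> link_verts \<sigma> \<Longrightarrow> t $ x > 0"
  by (simp add: link_cone_def)

lemma proj_cone:
  assumes \<sigma>: "\<sigma> \<in> X" and x: "x \<in> link_verts \<sigma>" and t: "t \<in> LC \<sigma>"
  shows "\<pi> \<sigma> x t \<in> LC (insert x \<sigma>)"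
proof -
  have x': "x \<notin> \<sigma>" "insert x \<sigma> \<in> X" using x mem_link_vertices[OF \<sigma>] by auto
  have "\<pi>s (insert x \<sigma>) xs (\<pi> \<sigma> x t) $ y > 0"
    if xs: "distinct xs" "set xs \<in> link X (insert x \<sigma>)" "y \<in> link_verts (insert x \<sigma> \<union> set xs)" for xs y
  proof -
    have "distinct (x # xs)" "set (x # xs) \<in> link X \<sigma>"
      using xs(1,2) x' \<sigma> by (auto simp: mem_link)
    moreover have "y \<in> link_verts (\<sigma> \<union> set (x # xs))" using xs(3) by simp
    ultimately have "\<pi>s \<sigma> (x # xs) t $ y > 0" using t mem_cone[OF \<sigma>] by blast
    then show ?thesis by simp
  qed
  then show ?thesis using mem_cone[OF x'(2)] proj_in_coord_space by blast
qed

text \<open>Each projection eliminates one site, so the projected vector still comes from a strictly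
  superharmonic function of the site, and such functions are positive.\<close>

lemma superharmonic_proj_list_pos:
  assumes "\<sigma> \<in> X" "superharmonic (sts \<sigma>) f" "\<And>y. y \<in> link_verts \<sigma> \<Longrightarrow> t $ y = f (st y)"
    "distinct xs" "set xs \<in> link X \<sigma>" "y \<in> link_verts (\<sigma> \<union> set xs)"
  shows "\<pi>s \<sigma> xs t $ y > 0"
  using assms
proof (induction xs arbitrary: \<sigma> f t)
  case Nil
  then show ?case using superharmonic_pos[OF Nil.prems(2), of "st y"] link_vertex_site[of \<sigma> y] by simp
next
  case (Cons x xs)
  have f: "insert x (\<sigma> \<union> set xs) \<in> X" "x \<notin> \<sigma>" "set xs \<inter> \<sigma> = {}"
    using Cons.prems(5) mem_link[OF Cons.prems(1)] by auto
  have ix: "insert x \<sigma> \<in> X" using face_subset[OF f(1)] by blast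
  then have x: "x \<in> link_verts \<sigma>" using f mem_link_vertices[OF Cons.prems(1)] by blast
  note sx = link_vertex_site[OF Cons.prems(1) x]
  let ?g = "\<lambda>s. f s - walk_sum V B W (insert (st x) (sts \<sigma>)) s (st x) * f (st x)"
  have "\<pi>s (insert x \<sigma>) xs (\<pi> \<sigma> x t) $ y > 0"
  proof (rule Cons.IH[of _ ?g])
    show "superharmonic (sts (insert x \<sigma>)) ?g"
      unfolding sx(3) by (rule superharmonic_eliminate[OF Cons.prems(2) sx(1,2)])
    show "\<pi> \<sigma> x t $ z = ?g (st z)" if "z \<in> link_verts (insert x \<sigma>)" for z
      using that Cons.prems(3)[OF x] Cons.prems(3)[of z] link_vertices_insert(1)[OF Cons.prems(1) x that]
      by (simp add: proj_nth)
    show "set xs \<in> link X (insert x \<sigma>)"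
      using f Cons.prems(4) by (simp add: mem_link[OF ix])
  qed (use Cons.prems ix in auto)
  then show ?case by simp
qed

text \<open>The cone is cut out by finitely many strict homogeneous linear inequalities, so only
  nonemptiness has content. The witness gives all spins of a site the value of a strictly
  superharmonic function there.\<close>

lemma open_convex_link_cone:
  assumes \<sigma>: "\<sigma> \<in> X"
  shows "open_convex_cone (link_verts \<sigma>) (LC \<sigma>)"
  unfolding open_convex_cone_def
proof (intro conjI ballI allI impI)
  let ?L = "{xs. distinct xs \<and> set xs \<in> link X \<sigma>}"
  obtain f where f: "superharmonic (sts \<sigma>) f" using superharmonic_exists' by blast
  define t :: "real ^ 'x" where "t = (\<chi> x. if x \<in> link_verts \<sigma> then f (st x) else 0)"
  have "t \<in> LC \<sigma>"
    unfolding mem_cone[OF \<sigma>]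
    by (auto simp: t_def coord_space_def intro!: superharmonic_proj_list_pos[OF \<sigma> f])
  then show "LC \<sigma> \<noteq> {}" by blast
  have lin: "linear (\<lambda>t. \<pi>s \<sigma> xs t $ y)" for xs y
    using linear_compose[OF linear_proj_list, of "\<lambda>t. t $ y" \<sigma> xs] by (simp add: comp_def linear_iff)
  have finL: "finite ?L"
    by (rule finite_subset[OF _ finite_subset_distinct[of UNIV]]) auto
  have "LC \<sigma> = coord_space (link_verts \<sigma>) \<inter> (\<Inter>xs\<in>?L. \<Inter>y\<in>link_verts (\<sigma> \<union> set xs). {t. 0 < \<pi>s \<sigma> xs t $ y})"
    using mem_cone[OF \<sigma>] by blast
  moreover have "open (\<Inter>xs\<in>?L. \<Inter>y\<in>link_verts (\<sigma> \<union> set xs). {t. 0 < \<pi>s \<sigma> xs t $ y})"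
    using finL lin by (intro open_INT ballI open_Collect_less continuous_on_const linear_continuous_on)
      (auto simp: linear_conv_bounded_linear)
  ultimately show "openin (top_of_set (coord_space (link_verts \<sigma>))) (LC \<sigma>)"
    unfolding openin_open by blast
  have sc: "c *\<^sub>R t \<in> LC \<sigma>" if "t \<in> LC \<sigma>" "c > 0" for t c
    using that subspace_scale[OF subspace_coord_space] by (auto simp: mem_cone[OF \<sigma>] linear_scale[OF linear_proj_list])
  then show "c *\<^sub>R t \<in> LC \<sigma>" if "t \<in> LC \<sigma>" "c > 0" for t c using that by blast
  have add: "s + t \<in> LC \<sigma>" if "s \<in> LC \<sigma>" "t \<in> LC \<sigma>" for s t
    using that subspace_add[OF subspace_coord_space]
    by (auto simp: mem_cone[OF \<sigma>] linear_add[OF linear_proj_list] intro!: add_pos_pos)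
  show "convex (LC \<sigma>)"
  proof (rule convexI)
    fix s t u v assume a: "s \<in> LC \<sigma>" "t \<in> LC \<sigma>" "0 \<le> u" "0 \<le> v" "u + v = (1::real)"
    show "u *\<^sub>R s + v *\<^sub>R t \<in> LC \<sigma>"
    proof (cases "u = 0 \<or> v = 0")
      case True
      then show ?thesis using a by auto
    next
      case False
      then show ?thesis using a by (intro add sc) auto
    qed
  qed
qed

section \<open>The polar form\<close>

text \<open>\<open>polar \<sigma> [v\<^sub>1, \<dots>, v\<^sub>k]\<close> is the iterated directional derivative of \<open>p\<^sub>\<sigma>\<close> when \<open>k = codim \<sigma>\<close>.\<close>

fun polar :: "'x set \<Rightarrow> (real ^ 'x) list \<Rightarrow> real" where
  "polar \<sigma> [] = \<mu> \<sigma>"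
| "polar \<sigma> (v # vs) = (\<Sum>x\<in>link_verts \<sigma>. v $ x * polar (insert x \<sigma>) (map (\<pi> \<sigma> x) vs))"

declare polar.simps(2) [simp del]

text \<open>The coefficient of \<open>a $ x * b $ y\<close> in
  \<open>polar \<sigma> (a # b # vs)\<close> for distinct \<open>x\<close> and \<open>y\<close>. The
  value 0 at non-edges lets all sums run over the vertices of one link.\<close>

definition polar_edge :: "'x set \<Rightarrow> (real ^ 'x) list \<Rightarrow> 'x \<Rightarrow> 'x \<Rightarrow> real" where
  "polar_edge \<sigma> vs x y = (if y \<in> link_verts (insert x \<sigma>)
    then polar (insert y (insert x \<sigma>)) (map (\<lambda>t. \<pi> (insert x \<sigma>) y (\<pi> \<sigma> x t)) vs) else 0)"

lemma polar_edge_sym: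
  assumes \<sigma>: "\<sigma> \<in> X" and x: "x \<in> link_verts \<sigma>" and y: "y \<in> link_verts \<sigma>"
  shows "polar_edge \<sigma> vs x y = polar_edge \<sigma> vs y x"
proof (cases "y \<in> link_verts (insert x \<sigma>)")
  case True
  then show ?thesis
    using link_vertices_insert(2)[OF \<sigma> x True] proj_commute[OF \<sigma> x True]
    by (simp add: polar_edge_def insert_commute)
next
  case False
  then have "x \<notin> link_verts (insert y \<sigma>)" using link_vertices_insert(2)[OF \<sigma> y] by blast
  then show ?thesis using False by (simp add: polar_edge_def)
qed

text \<open>Two levels of the recursion: the projected \<open>b\<close> has entry
  \<open>b $ y - hit \<sigma> x y * b $ x\<close>, which splits the form into an edge part and a
  diagonal part. The diagonal part is visibly symmetric in \<open>a\<close> and \<open>b\<close>;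
  the edge part is so by \<open>polar_edge_sym\<close>.\<close>

lemma polar_Cons_Cons:
  assumes \<sigma>: "\<sigma> \<in> X"
  shows "polar \<sigma> (a # b # vs) =
    (\<Sum>x\<in>link_verts \<sigma>. \<Sum>y\<in>link_verts \<sigma>. a $ x * b $ y * polar_edge \<sigma> vs x y)
    - (\<Sum>x\<in>link_verts \<sigma>. \<Sum>y\<in>link_verts \<sigma>. a $ x * b $ x * hit \<sigma> x y * polar_edge \<sigma> vs x y)"
proof -
  have "a $ x * polar (insert x \<sigma>) (map (\<pi> \<sigma> x) (b # vs))
    = (\<Sum>y\<in>link_verts \<sigma>. a $ x * b $ y * polar_edge \<sigma> vs x y - a $ x * b $ x * hit \<sigma> x y * polar_edge \<sigma> vs x y)"
    if x: "x \<in> link_verts \<sigma>" for x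
  proof -
    have sub: "link_verts (insert x \<sigma>) \<subseteq> link_verts \<sigma>" using link_vertices_insert(1)[OF \<sigma> x] by blast
    have "a $ x * polar (insert x \<sigma>) (map (\<pi> \<sigma> x) (b # vs)) =
      (\<Sum>y\<in>link_verts (insert x \<sigma>). a $ x * b $ y * polar_edge \<sigma> vs x y - a $ x * b $ x * hit \<sigma> x y * polar_edge \<sigma> vs x y)"
      unfolding list.map polar.simps(2) sum_distrib_left
      by (intro sum.cong refl) (simp add: polar_edge_def proj_nth comp_def algebra_simps)
    also have "\<dots> = (\<Sum>y\<in>link_verts \<sigma>. a $ x * b $ y * polar_edge \<sigma> vs x y - a $ x * b $ x * hit \<sigma> x y * polar_edge \<sigma> vs x y)"
      using sub by (intro sum.mono_neutral_left) (auto simp: polar_edge_def)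
    finally show ?thesis .
  qed
  then show ?thesis unfolding polar.simps(2)[of \<sigma> a] by (simp add: sum_subtractf)
qed

lemma polar_swap:
  assumes \<sigma>: "\<sigma> \<in> X"
  shows "polar \<sigma> (a # b # vs) = polar \<sigma> (b # a # vs)"
proof -
  have "(\<Sum>x\<in>link_verts \<sigma>. \<Sum>y\<in>link_verts \<sigma>. a $ x * b $ y * polar_edge \<sigma> vs x y)
    = (\<Sum>y\<in>link_verts \<sigma>. \<Sum>x\<in>link_verts \<sigma>. a $ x * b $ y * polar_edge \<sigma> vs x y)" by (rule sum.swap)
  also have "\<dots> = (\<Sum>y\<in>link_verts \<sigma>. \<Sum>x\<in>link_verts \<sigma>. b $ y * a $ x * polar_edge \<sigma> vs y x)"
    using polar_edge_sym[OF \<sigma>] by (intro sum.cong refl) auto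
  finally show ?thesis unfolding polar_Cons_Cons[OF \<sigma>] by (simp add: mult_ac)
qed

text \<open>Adjacent swaps generate all permutations. A swap below the head takes place inside the
  links, where the vectors have been replaced by their projections; hence the induction on the
  length.\<close>

lemma polar_to_front:
  assumes "\<sigma> \<in> X"
  shows "polar \<sigma> (us @ v # ws) = polar \<sigma> (v # us @ ws)"
  using assms
proof (induction "length us" arbitrary: us \<sigma> v ws)
  case (Suc n)
  then obtain u us' where us: "us = u # us'" "n = length us'" by (cases us) auto
  have "polar \<sigma> (u # us' @ v # ws) = polar \<sigma> (u # v # us' @ ws)"
    unfolding polar.simps(2)[of \<sigma> u]
  proof (intro sum.cong refl)
    fix x assume "x \<in> link_verts \<sigma>"
    then have "insert x \<sigma> \<in> X" using Suc.prems mem_link_vertices by blast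
    then show "u $ x * polar (insert x \<sigma>) (map (\<pi> \<sigma> x) (us' @ v # ws))
      = u $ x * polar (insert x \<sigma>) (map (\<pi> \<sigma> x) (v # us' @ ws))"
      using Suc.hyps(1)[of "map (\<pi> \<sigma> x) us'"] us(2) by simp
  qed
  then show ?case using polar_swap[OF Suc.prems] us by simp
qed simp

lemma linear_polar: "linear (\<lambda>a. polar \<sigma> (a # vs))"
  by (rule linearI) (simp_all add: polar.simps(2) algebra_simps sum.distrib sum_distrib_left)

lemma bilinear_polar: "\<sigma> \<in> X \<Longrightarrow> bilinear (\<lambda>a b. polar \<sigma> (a # b # vs))"
proof -
  assume \<sigma>: "\<sigma> \<in> X"
  have "(\<lambda>b. polar \<sigma> (a # b # vs)) = (\<lambda>b. polar \<sigma> (b # a # vs))" for a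
    using polar_swap[OF \<sigma>] by (intro ext)
  then show ?thesis unfolding bilinear_def using linear_polar by auto
qed

lemma polar_axis:
  "x \<in> link_verts \<sigma> \<Longrightarrow> polar \<sigma> (axis x 1 # vs) = polar (insert x \<sigma>) (map (\<pi> \<sigma> x) vs)"
  unfolding polar.simps(2) by (simp add: axis_def if_distrib[of "\<lambda>c. c * _"] cong: if_cong)

lemma polar_coord: "polar \<sigma> (a # vs) = (\<Sum>x\<in>link_verts \<sigma>. a $ x * polar \<sigma> (axis x 1 # vs))"
  unfolding polar.simps(2)[of \<sigma> a] by (intro sum.cong) (simp_all add: polar_axis)

lemma polar_axis_axis:
  assumes \<sigma>: "\<sigma> \<in> X" and xy: "x \<in> link_verts \<sigma>" "y \<in> link_verts \<sigma>" "x \<noteq> y"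
  shows "polar \<sigma> (axis x 1 # axis y 1 # vs) = polar_edge \<sigma> vs x y"
proof -
  have 1: "axis x (1::real) $ u * axis y 1 $ v * p = (if u = x then if v = y then p else 0 else 0)" for u v p
    by (auto simp: axis_def)
  have 2: "axis x (1::real) $ u * axis y 1 $ u * p = 0" for u p
    using xy(3) by (auto simp: axis_def)
  have 3: "(\<Sum>v\<in>link_verts \<sigma>. if u = x then if v = y then p v else 0 else 0) = (if u = x then p y else 0)"
    for u and p :: "'x \<Rightarrow> real"
    using xy(2) by auto
  show ?thesis unfolding polar_Cons_Cons[OF \<sigma>] 2 unfolding 1 3 using xy by simp
qed

lemma quad_form_polar:
  assumes "\<sigma> \<in> X"
  shows "quad_form (link_verts \<sigma>) (\<lambda>x y. polar \<sigma> (axis x 1 # axis y 1 # vs)) a = polar \<sigma> (a # a # vs)"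
proof -
  have "polar \<sigma> (axis x 1 # a # vs) = (\<Sum>y\<in>link_verts \<sigma>. a $ y * polar \<sigma> (axis x 1 # axis y 1 # vs))" for x
    unfolding polar_swap[OF assms, of "axis x 1"] by (rule polar_coord)
  then show ?thesis
    unfolding quad_form_def polar_coord[of \<sigma> a "a # vs"] by (simp add: sum_distrib_left mult_ac)
qed

lemma polar_pos:
  assumes "\<sigma> \<in> X" "card \<sigma> + length vs = d" "set vs \<subseteq> LC \<sigma>"
  shows "polar \<sigma> vs > 0"
  using assms
proof (induction "length vs" arbitrary: \<sigma> vs)
  case 0
  then show ?case using facet_pos facet_iff by simp
next
  case (Suc n)
  then obtain v us where vs: "vs = v # us" "n = length us" by (cases vs) auto
  have "polar (insert x \<sigma>) (map (\<pi> \<sigma> x) us) > 0" if x: "x \<in> link_verts \<sigma>" for x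
  proof (rule Suc.hyps(1))
    show "insert x \<sigma> \<in> X" using x mem_link_vertices Suc.prems(1) by blast
    show "card (insert x \<sigma>) + length (map (\<pi> \<sigma> x) us) = d"
      using Suc.prems x vs by (simp add: card_insert_link)
    show "set (map (\<pi> \<sigma> x) us) \<subseteq> LC (insert x \<sigma>)"
      using Suc.prems(3) vs proj_cone[OF Suc.prems(1) x] by auto
  qed (use vs in simp)
  moreover have "v $ x > 0" if "x \<in> link_verts \<sigma>" for x
    using Suc.prems(3) vs cone_pos that by auto
  moreover have "link_verts \<sigma> \<noteq> {}"
    using link_vertices_nonempty Suc.prems Suc.hyps(2) by simp
  ultimately show ?case unfolding vs polar.simps(2) by (intro sum_pos) auto
qed

section \<open>Derivatives of the polynomials\<close>

text \<open>The factorial collects the divisions by the codimension along the recursion.\<close>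

lemma link_poly_polar:
  "link_poly_codim n V S X \<mu> B W \<sigma> t = polar \<sigma> (replicate n t) / fact n"
proof (induction n arbitrary: \<sigma> t)
  case (Suc n)
  have "link_poly_codim (Suc n) V S X \<mu> B W \<sigma> t
    = (\<Sum>x\<in>link_verts \<sigma>. t $ x * polar (insert x \<sigma>) (replicate n (\<pi> \<sigma> x t))) / fact n / real (Suc n)"
    by (simp only: link_poly_codim.simps Suc.IH times_divide_eq_right sum_divide_distrib)
  then show ?case
    by (simp add: polar.simps(2) map_replicate mult.commute)
qed simp

text \<open>The moving point is taken out of one argument at a time, where the form is linear, and
  the product rule applies. The prefix \<open>us\<close> collects the arguments already
  frozen.\<close>

lemma polar_has_derivative:
  assumes "\<sigma> \<in> X"
  shows "((\<lambda>s. polar \<sigma> (us @ replicate (Suc m) (t + s *\<^sub>R v))) has_real_derivative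
    real (Suc m) * polar \<sigma> (v # us @ replicate m t)) (at 0)"
proof (induction m arbitrary: us)
  case 0
  have "polar \<sigma> (us @ replicate (Suc 0) (t + s *\<^sub>R v)) = polar \<sigma> (t # us) + s * polar \<sigma> (v # us)" for s
    using polar_to_front[OF assms, of us _ "[]"]
    by (simp add: linear_add[OF linear_polar] linear_scale[OF linear_polar])
  then show ?case by (auto intro!: derivative_eq_intros)
next
  case (Suc m)
  let ?r = "\<lambda>s. replicate (Suc m) (t + s *\<^sub>R v)"
  have split: "polar \<sigma> (us @ replicate (Suc (Suc m)) (t + s *\<^sub>R v))
      = polar \<sigma> ((t # us) @ ?r s) + s * polar \<sigma> ((v # us) @ ?r s)" for s
    using polar_to_front[OF assms, of us "t + s *\<^sub>R v" "?r s"]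
    by (simp add: linear_add[OF linear_polar] linear_scale[OF linear_polar])
  have "((\<lambda>s. polar \<sigma> ((t # us) @ ?r s) + s * polar \<sigma> ((v # us) @ ?r s)) has_real_derivative
    real (Suc m) * polar \<sigma> (v # (t # us) @ replicate m t)
    + (1 * polar \<sigma> ((v # us) @ ?r 0) + real (Suc m) * polar \<sigma> (v # (v # us) @ replicate m t) * 0)) (at 0)"
    by (intro DERIV_add DERIV_mult Suc.IH DERIV_ident)
  moreover have "polar \<sigma> (v # (t # us) @ replicate m t) = polar \<sigma> (v # us @ replicate (Suc m) t)"
  proof -
    have "polar \<sigma> (v # us @ t # replicate m t) = polar \<sigma> (t # (v # us) @ replicate m t)"
      using polar_to_front[OF assms, of "v # us" t "replicate m t"] by simp
    also have "\<dots> = polar \<sigma> (v # t # us @ replicate m t)" using polar_swap[OF assms] by simp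
    finally show ?thesis by simp
  qed
  ultimately show ?case unfolding split by (simp add: algebra_simps)
qed

text \<open>Here \<open>m\<close> arguments still equal the point of evaluation. All
  \<open>m\<close> are needed at once, because each outer derivative acts on the inner one as a
  function; with \<open>m = 0\<close> the result no longer depends on \<open>t\<close>.\<close>

lemma foldr_dir_deriv:
  assumes \<sigma>: "\<sigma> \<in> X"
  shows "foldr dir_deriv vs (link_poly_codim (length vs + m) V S X \<mu> B W \<sigma>) t
    = polar \<sigma> (vs @ replicate m t) / fact m"
proof (induction vs arbitrary: m t)
  case Nil
  then show ?case by (simp add: link_poly_polar)
next
  case (Cons v vs)
  have "foldr dir_deriv vs (link_poly_codim (length (v # vs) + m) V S X \<mu> B W \<sigma>)
    = (\<lambda>t. polar \<sigma> (vs @ replicate (Suc m) t) / fact (Suc m))"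
  proof
    fix t
    have e: "length (v # vs) + m = length vs + Suc m" by simp
    show "foldr dir_deriv vs (link_poly_codim (length (v # vs) + m) V S X \<mu> B W \<sigma>) t
      = polar \<sigma> (vs @ replicate (Suc m) t) / fact (Suc m)"
      unfolding e by (rule Cons.IH)
  qed
  then have "foldr dir_deriv (v # vs) (link_poly_codim (length (v # vs) + m) V S X \<mu> B W \<sigma>) t
    = deriv (\<lambda>s. polar \<sigma> (vs @ replicate (Suc m) (t + s *\<^sub>R v)) / fact (Suc m)) 0"
    by (simp add: dir_deriv_def)
  also have "\<dots> = real (Suc m) * polar \<sigma> (v # vs @ replicate m t) / fact (Suc m)"
    by (rule DERIV_imp_deriv[OF DERIV_cdivide[OF polar_has_derivative[OF \<sigma>]]])
  also have "\<dots> = polar \<sigma> ((v # vs) @ replicate m t) / fact m"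
    by (simp del: of_nat_Suc)
  finally show ?case .
qed

lemma real_polynomial_link_poly: "real_polynomial_function (link_poly_codim n V S X \<mu> B W \<sigma>)"
proof (induction n arbitrary: \<sigma>)
  case 0
  have "link_poly_codim 0 V S X \<mu> B W \<sigma> = (\<lambda>_. \<mu> \<sigma>)" by (intro ext) simp
  then show ?case by auto
next
  case (Suc n)
  have "link_poly_codim (Suc n) V S X \<mu> B W \<sigma> = (\<lambda>t. (\<Sum>x\<in>link_verts \<sigma>.
      t $ x * (link_poly_codim n V S X \<mu> B W (insert x \<sigma>) \<circ> \<pi> \<sigma> x) t) / real (Suc n))"
    by (intro ext) simp
  moreover have "real_polynomial_function (link_poly_codim n V S X \<mu> B W (insert x \<sigma>) \<circ> \<pi> \<sigma> x)" for x
    using linear_proj Suc.IH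
    by (intro real_polynomial_function_compose polynomial_function_bounded_linear)
      (auto simp: linear_conv_bounded_linear)
  moreover have "real_polynomial_function (\<lambda>t :: real ^ 'x. t $ x)" for x
    using bounded_linear_vec_nth by blast
  ultimately show ?case
    by (simp only: ) (intro real_polynomial_function_divide real_polynomial_function_sum
        real_polynomial_function.intros(4) finite)
qed

lemma link_poly_homogeneous:
  "link_poly_codim n V S X \<mu> B W \<sigma> (c *\<^sub>R t) = c ^ n * link_poly_codim n V S X \<mu> B W \<sigma> t"
  by (induction n arbitrary: \<sigma> t) (simp_all add: linear_scale[OF linear_proj] sum_distrib_left mult_ac)

end

section \<open>Lorentzian signature\<close>

locale spectral_complex = walk_complex V B W d S X \<mu>
  for V B :: "'v set" and W d and S :: "'v \<Rightarrow> ('x::finite) set" and X \<mu> +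
  assumes connected: "connected_complex d X"
    and spectral_bound: "\<And>\<sigma> u v. \<lbrakk>\<sigma> \<in> X; card \<sigma> + 2 = d; u \<noteq> v; V - sites V S \<sigma> = {u, v}\<rbrakk> \<Longrightarrow>
           lambda2 (link_vertices X \<sigma>) (walk_matrix X \<mu> \<sigma>) \<le> sqrt (W u v * W v u)"
begin

section \<open>Codimension 2: the link as a weighted bipartite graph\<close>

lemma link_edge_iff:
  assumes \<sigma>: "\<sigma> \<in> X" and "x \<in> link_verts \<sigma>" "y \<in> link_verts \<sigma>"
  shows "{x, y} \<in> link_edges X \<sigma> \<longleftrightarrow> y \<in> link_verts (insert x \<sigma>)"
proof -
  have x: "x \<notin> \<sigma>" "insert x \<sigma> \<in> X" "y \<notin> \<sigma>" using assms mem_link_vertices by auto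
  have "{x, y} \<in> link_edges X \<sigma> \<longleftrightarrow> x \<noteq> y \<and> \<sigma> \<union> {x, y} \<in> X"
    using x by (auto simp: link_edges_def mem_link[OF \<sigma>] card_insert_if)
  also have "\<sigma> \<union> {x, y} = insert y (insert x \<sigma>)" by auto
  finally show ?thesis using x by (auto simp: mem_link_vertices[OF x(2)])
qed

text \<open>In codimension 2 an edge completes the face to a facet, so the sum defining the weight
  has a single term.\<close>

lemma link_weight_polar_edge:
  assumes \<sigma>: "\<sigma> \<in> X" "card \<sigma> + 2 = d" and xy: "x \<in> link_verts \<sigma>" "y \<in> link_verts \<sigma>"
  shows "link_weight X \<mu> \<sigma> x y = polar_edge \<sigma> [] x y"
proof (cases "y \<in> link_verts (insert x \<sigma>)")
  case True
  note f = link_vertices_insert[OF \<sigma>(1) xy(1) True]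
  have c: "card (insert y (insert x \<sigma>)) = d"
    using card_insert_link[OF \<sigma>(1) xy(1)] card_insert_link[OF f(4) True] \<sigma>(2) by simp
  have "{\<omega>. \<omega> \<in> facets X \<and> \<sigma> \<union> {x, y} \<subseteq> \<omega>} = {insert y (insert x \<sigma>)}"
  proof (intro equalityI subsetI)
    fix \<omega> assume "\<omega> \<in> {\<omega>. \<omega> \<in> facets X \<and> \<sigma> \<union> {x, y} \<subseteq> \<omega>}"
    then have "insert y (insert x \<sigma>) \<subseteq> \<omega>" "card \<omega> = d" using card_facet[OF partite] by auto
    then have "insert y (insert x \<sigma>) = \<omega>" using c by (intro card_subset_eq) auto
    then show "\<omega> \<in> {insert y (insert x \<sigma>)}" by simp
  qed (use facet_iff[OF f(6)] c in auto)
  then show ?thesis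
    using True link_edge_iff[OF \<sigma>(1) xy] by (simp add: link_weight_def polar_edge_def)
next
  case False
  then show ?thesis using link_edge_iff[OF \<sigma>(1) xy] by (simp add: link_weight_def polar_edge_def)
qed

text \<open>The edge part of the form is the adjacency form of the link, whose two sides are the
  spins of \<open>u\<close> and of \<open>v\<close>. \<open>bipartite_form_le\<close> bounds it by
  degrees weighted with \<open>W v u\<close> and \<open>W u v\<close>, and the diagonal part
  subtracts at least that much.\<close>

lemma hyperplane_codim_2:
  assumes \<sigma>: "\<sigma> \<in> X" "card \<sigma> + 2 = d"
  shows "\<exists>c. \<forall>a. c \<bullet> a = 0 \<longrightarrow> polar \<sigma> [a, a] \<le> 0"
proof -
  let ?A = "link_verts \<sigma>"
  define w where "w = link_weight X \<mu> \<sigma>"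
  define D where "D x = (\<Sum>z\<in>?A. w x z)" for x
  have we: "w x y = polar_edge \<sigma> [] x y" if "x \<in> ?A" "y \<in> ?A" for x y
    using link_weight_polar_edge[OF \<sigma> that] by (simp add: w_def)
  have edge_pos: "w x y > 0" if x: "x \<in> ?A" and y: "y \<in> link_verts (insert x \<sigma>)" for x y
  proof -
    note f = link_vertices_insert[OF \<sigma>(1) x y]
    have "polar (insert y (insert x \<sigma>)) [] > 0"
      using card_insert_link[OF \<sigma>(1) x] card_insert_link[OF f(4) y] \<sigma>(2) by (intro polar_pos f(6)) auto
    then show ?thesis using we[OF x f(1)] y by (simp add: polar_edge_def)
  qed
  have no_edge: "w x y = 0" if "x \<in> ?A" "y \<in> ?A" "y \<notin> link_verts (insert x \<sigma>)" for x y
    using we that by (simp add: polar_edge_def)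
  have w0: "w x y \<ge> 0" if "x \<in> ?A" "y \<in> ?A" for x y
    using edge_pos[of x y] no_edge[OF that] that by (cases "y \<in> link_verts (insert x \<sigma>)") auto
  have nbr: "\<exists>y. y \<in> link_verts (insert x \<sigma>)" if "x \<in> ?A" for x
    using link_vertices_nonempty[of "insert x \<sigma>"] card_insert_link[OF \<sigma>(1) that] \<sigma>(2)
      mem_link_vertices[OF \<sigma>(1)] that by fastforce
  have Dpos: "D x > 0" if x: "x \<in> ?A" for x
  proof -
    obtain y where y: "y \<in> link_verts (insert x \<sigma>)" using nbr[OF x] by blast
    have "y \<in> ?A" using link_vertices_insert(1)[OF \<sigma>(1) x y] .
    then show ?thesis unfolding D_def using edge_pos[OF x y] w0[OF x] by (intro sum_pos2[of _ y]) auto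
  qed
  have "card (V - sts \<sigma>) = 2"
    using card_Diff_subset[of "sts \<sigma>" V] sites_subset[of \<sigma>] finite_states card_V card_sites[OF \<sigma>(1)] \<sigma>(2)
      finite_subset[OF sites_subset[of \<sigma>]] by simp
  then obtain u v where uv: "V - sts \<sigma> = {u, v}" "u \<noteq> v" by (auto simp: card_2_iff)
  have st: "st x = u \<or> st x = v" if "x \<in> ?A" for x
    using link_vertex_site[OF \<sigma>(1) that] uv by blast
  define g where "g x \<longleftrightarrow> st x = u" for x
  have st_edge: "st y \<noteq> st x" if x: "x \<in> ?A" and y: "y \<in> link_verts (insert x \<sigma>)" for x y
    using link_vertex_site(2)[OF link_vertices_insert(4)[OF \<sigma>(1) x y] y] link_vertex_site(3)[OF \<sigma>(1) x] by auto
  \<comment> \<open>Only \<open>st y\<close> itself is available as an interior vertex, so the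
    hitting sum exceeds the one-step probability at most through loops.\<close>
  have hit_ge: "W (st y) (st x) \<le> hit \<sigma> x y" if x: "x \<in> ?A" and y: "y \<in> link_verts (insert x \<sigma>)" for x y
  proof -
    have "st y \<in> V" "st y \<notin> insert (st x) (sts \<sigma>)"
      using link_vertex_site[OF link_vertices_insert(4)[OF \<sigma>(1) x y] y] link_vertex_site(3)[OF \<sigma>(1) x] by auto
    then show ?thesis using link_vertex_site(1)[OF \<sigma>(1) x] by (intro walk_sum_ge) auto
  qed
  have card: "card ?A \<ge> 2"
  proof -
    obtain x where x: "x \<in> ?A" using link_vertices_nonempty[OF \<sigma>(1)] \<sigma>(2) by auto
    obtain y where y: "y \<in> link_verts (insert x \<sigma>)" using nbr[OF x] by blast
    have "{x, y} \<subseteq> ?A" "x \<noteq> y" using x link_vertices_insert[OF \<sigma>(1) x y] by auto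
    then show ?thesis using card_mono[of ?A "{x, y}"] by simp
  qed
  \<comment> \<open>The hyperplane asks for weighted mean zero on the spins of \<open>v\<close>
    alone.\<close>
  define c :: "real ^ 'x" where "c = (\<chi> x. if x \<in> ?A \<and> \<not> g x then D x else 0)"
  have "polar \<sigma> [a, a] \<le> 0" if ca: "c \<bullet> a = 0" for a
  proof -
    have "c \<in> coord_space ?A" by (simp add: c_def coord_space_def)
    from inner_coord_space(1)[OF this, of a] have "(\<Sum>x\<in>?A. c $ x * a $ x) = 0" using ca by simp
    also have "(\<Sum>x\<in>?A. c $ x * a $ x) = (\<Sum>x\<in>?A. if g x then 0 else D x * a $ x)"
      by (intro sum.cong) (auto simp: c_def)
    finally have a0: "(\<Sum>x\<in>?A. if g x then 0 else D x * a $ x) = 0" .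
    have "walk_matrix X \<mu> \<sigma> = (\<lambda>x y. w x y / D x)" by (simp add: fun_eq_iff walk_matrix_def w_def D_def)
    then have l2: "lambda2 ?A (\<lambda>x y. w x y / D x) \<le> sqrt (W v u * W u v)"
      using spectral_bound[OF \<sigma> uv(2,1)] by (simp add: mult.commute)
    have le: "quad_form ?A w a \<le> (\<Sum>x\<in>?A. (if g x then W v u else W u v) * (D x * (a $ x)\<^sup>2))"
    proof (rule bipartite_form_le[OF _ w0 _ Dpos card _ _ _ l2 a0])
      show "w x y = w y x" if "x \<in> ?A" "y \<in> ?A" for x y
        using that polar_edge_sym[OF \<sigma>(1) that] by (simp add: we)
      show "w x y = 0" if "x \<in> ?A" "y \<in> ?A" "g x = g y" for x y
      proof -
        have "st x = st y" using that st[of x] st[of y] by (auto simp: g_def)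
        then show ?thesis using no_edge[OF that(1,2)] st_edge[OF that(1), of y] by fastforce
      qed
      show "W v u \<ge> 0" "W u v \<ge> 0" using uv W_nonneg by auto
    qed (auto simp: D_def)
    have "(\<Sum>x\<in>?A. (if g x then W v u else W u v) * (D x * (a $ x)\<^sup>2))
      \<le> (\<Sum>x\<in>?A. \<Sum>y\<in>?A. a $ x * a $ x * hit \<sigma> x y * polar_edge \<sigma> [] x y)"
    proof (rule sum_mono)
      fix x assume x: "x \<in> ?A"
      have "(if g x then W v u else W u v) * (D x * (a $ x)\<^sup>2)
        = (\<Sum>y\<in>?A. (a $ x)\<^sup>2 * ((if g x then W v u else W u v) * w x y))"
        by (simp add: D_def sum_distrib_left sum_distrib_right mult_ac)
      also have "\<dots> \<le> (\<Sum>y\<in>?A. (a $ x)\<^sup>2 * (hit \<sigma> x y * w x y))"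
      proof (intro sum_mono mult_left_mono)
        fix y assume y: "y \<in> ?A"
        show "(if g x then W v u else W u v) * w x y \<le> hit \<sigma> x y * w x y"
        proof (cases "y \<in> link_verts (insert x \<sigma>)")
          case True
          \<comment> \<open>Adjacent spins sit at different sites, so the coefficient attached to
            \<open>x\<close> is the transition from the site of any neighbour to that of
            \<open>x\<close>.\<close>
          then have "(if g x then W v u else W u v) = W (st y) (st x)"
            using st_edge[OF x True] st[OF x] st[OF y] uv(2) by (auto simp: g_def)
          then show ?thesis using hit_ge[OF x True] w0[OF x y] by (simp add: mult_right_mono)
        next
          case False
          then show ?thesis using no_edge[OF x y] by simp
        qed
      qed simp
      also have "\<dots> = (\<Sum>y\<in>?A. a $ x * a $ x * hit \<sigma> x y * polar_edge \<sigma> [] x y)"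
        using we[OF x] by (intro sum.cong refl) (simp add: power2_eq_square mult.assoc)
      finally show "(if g x then W v u else W u v) * (D x * (a $ x)\<^sup>2)
        \<le> (\<Sum>y\<in>?A. a $ x * a $ x * hit \<sigma> x y * polar_edge \<sigma> [] x y)" .
    qed
    moreover have "quad_form ?A w a = (\<Sum>x\<in>?A. \<Sum>y\<in>?A. a $ x * a $ y * polar_edge \<sigma> [] x y)"
      unfolding quad_form_def using we by (intro sum.cong refl) (simp add: mult_ac)
    ultimately show ?thesis using le unfolding polar_Cons_Cons[OF \<sigma>(1)] by simp
  qed
  then show ?thesis by blast
qed

text \<open>One vector \<open>w\<close> of \<open>vs\<close> takes the part of the distinguished
  cone vector, and the remaining ones, \<open>us\<close>, are projected into the links. The
  hyperplane obtained is the orthogonal complement, in the weights \<open>D\<close>, of the Perron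
  vector \<open>w\<close>.\<close>

lemma hyperplane:
  assumes "\<sigma> \<in> X" "card \<sigma> + (length vs + 2) = d" "set vs \<subseteq> LC \<sigma>"
  shows "\<exists>c. \<forall>a. c \<bullet> a = 0 \<longrightarrow> polar \<sigma> (a # a # vs) \<le> 0"
  using assms
proof (induction "length vs" arbitrary: \<sigma> vs)
  case 0
  then show ?case using hyperplane_codim_2[of \<sigma>] by simp
next
  case (Suc n)
  note \<sigma> = Suc.prems(1)
  let ?A = "link_verts \<sigma>"
  obtain w us where vs: "vs = w # us" "n = length us" using Suc.hyps(2) by (cases vs) auto
  have w: "w \<in> LC \<sigma>" and us: "set us \<subseteq> LC \<sigma>" using Suc.prems(3) vs by auto
  define M where "M x y = polar \<sigma> (axis x 1 # axis y 1 # vs)" for x y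
  define Q where "Q x a b = polar (insert x \<sigma>) (\<pi> \<sigma> x a # \<pi> \<sigma> x b # map (\<pi> \<sigma> x) us)" for x a b
  \<comment> \<open>This weight makes \<open>w\<close> an eigenvector for 1, since row
    \<open>x\<close> of \<open>M\<close> applied to \<open>a\<close> is
    \<open>Q x a w\<close>.\<close>
  define D where "D x = Q x w w / w $ x" for x
  have wpos: "w $ x > 0" if "x \<in> ?A" for x using cone_pos[OF w that] .
  have ins: "insert x \<sigma> \<in> X" "card (insert x \<sigma>) + (length us + 2) = d"
    "set (map (\<pi> \<sigma> x) us) \<subseteq> LC (insert x \<sigma>)" if x: "x \<in> ?A" for x
    using that mem_link_vertices[OF \<sigma>] card_insert_link[OF \<sigma> x] Suc.prems(2) vs proj_cone[OF \<sigma> x] us by auto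
  have Qpos: "Q x w w > 0" if x: "x \<in> ?A" for x
    unfolding Q_def using ins[OF x] proj_cone[OF \<sigma> x w] by (intro polar_pos) auto
  have rcs: "Q x w w * Q x a a \<le> (Q x a w)\<^sup>2" if x: "x \<in> ?A" for x a
  proof -
    obtain c where c: "\<And>a. c \<bullet> a = 0 \<Longrightarrow> polar (insert x \<sigma>) (a # a # map (\<pi> \<sigma> x) us) \<le> 0"
      using Suc.hyps(1)[of "map (\<pi> \<sigma> x) us" "insert x \<sigma>"] ins[OF x] vs(2) by auto
    show ?thesis
      unfolding Q_def
      by (rule reversed_cauchy_schwarz[OF bilinear_polar[OF ins(1)[OF x]] polar_swap[OF ins(1)[OF x]] c
            Qpos[OF x, unfolded Q_def]])
  qed
  have Mrow: "(\<Sum>y\<in>?A. M x y * a $ y) = Q x a w" if x: "x \<in> ?A" for x a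
  proof -
    have "(\<Sum>y\<in>?A. M x y * a $ y) = (\<Sum>y\<in>?A. a $ y * polar \<sigma> (axis y 1 # axis x 1 # vs))"
      unfolding M_def polar_swap[OF \<sigma>, of "axis x 1"] by (simp add: mult.commute)
    also have "\<dots> = polar \<sigma> (axis x 1 # a # vs)"
      unfolding polar_swap[OF \<sigma>, of "axis x 1" a] by (rule polar_coord[symmetric])
    finally show ?thesis by (simp add: polar_axis[OF x] Q_def vs)
  qed
  have edge: "M x y = polar_edge \<sigma> vs x y" if "x \<in> ?A" "y \<in> ?A" "x \<noteq> y" for x y
    unfolding M_def using polar_axis_axis[OF \<sigma> that] .
  have edge_pos: "polar_edge \<sigma> vs x y > 0" if x: "x \<in> ?A" and y: "y \<in> link_verts (insert x \<sigma>)" for x y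
  proof -
    note f = link_vertices_insert[OF \<sigma> x y]
    have "\<pi> (insert x \<sigma>) y (\<pi> \<sigma> x t) \<in> LC (insert y (insert x \<sigma>))" if "t \<in> LC \<sigma>" for t
      using proj_cone[OF f(4) y proj_cone[OF \<sigma> x that]] .
    then have "polar (insert y (insert x \<sigma>)) (map (\<lambda>t. \<pi> (insert x \<sigma>) y (\<pi> \<sigma> x t)) vs) > 0"
      using card_insert_link[OF \<sigma> x] card_insert_link[OF f(4) y] Suc.prems by (intro polar_pos f(6)) auto
    then show ?thesis using y by (simp add: polar_edge_def)
  qed
  define c :: "real ^ 'x" where "c = (\<chi> x. if x \<in> ?A then D x * w $ x else 0)"
  have "polar \<sigma> (a # a # vs) \<le> 0" if ca: "c \<bullet> a = 0" for a
  proof -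
    have "c \<in> coord_space ?A" by (simp add: c_def coord_space_def)
    from inner_coord_space(1)[OF this, of a] have "(\<Sum>x\<in>?A. c $ x * a $ x) = 0" using ca by simp
    then have a0: "(\<Sum>x\<in>?A. D x * w $ x * a $ x) = 0" by (simp add: c_def)
    have "quad_form ?A M a \<le> 0"
    proof (rule trickle_down_form[where w = "\<lambda>x. w $ x" and D = D, OF _ _ _ wpos _ _ _ a0])
      show "M x y = M y x" for x y unfolding M_def by (rule polar_swap[OF \<sigma>])
      show "M x y \<ge> 0" if "x \<in> ?A" "y \<in> ?A" "x \<noteq> y" for x y
        using edge[OF that] edge_pos[OF that(1), of y] by (cases "y \<in> link_verts (insert x \<sigma>)") (auto simp: polar_edge_def)
      show "D x > 0" if "x \<in> ?A" for x using Qpos[OF that] wpos[OF that] by (simp add: D_def)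
      show "(\<Sum>y\<in>?A. M x y * w $ y) = D x * w $ x" if "x \<in> ?A" for x
        using Mrow[OF that] wpos[OF that] by (simp add: D_def)
      show "(x, y) \<in> {(x, y). x \<in> ?A \<and> y \<in> ?A \<and> x \<noteq> y \<and> M x y > 0}\<^sup>*" if xy: "x \<in> ?A" "y \<in> ?A" for x y
      proof -
        have "(x, y) \<in> {(a, b). {a, b} \<in> link_edges X \<sigma>}\<^sup>*"
          using connected \<sigma> xy Suc.prems(2) by (auto simp: connected_complex_def)
        then show ?thesis
        \<comment> \<open>Edges of the link are positive entries of \<open>M\<close>, so
          connectedness of the link passes to the matrix.\<close>
        proof (rule rtrancl_mono[THEN subsetD, rotated], clarify)
          fix a b assume ab: "{a, b} \<in> link_edges X \<sigma>"
          then have "{a, b} \<in> link X \<sigma>" by (simp add: link_edges_def)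
          then have "\<sigma> \<union> {a, b} \<in> X" "{a, b} \<inter> \<sigma> = {}" using mem_link[OF \<sigma>] by auto
          then have m: "a \<in> ?A" "b \<in> ?A"
            using face_subset[of "\<sigma> \<union> {a, b}"] by (auto simp: mem_link_vertices[OF \<sigma>])
          have b: "b \<in> link_verts (insert a \<sigma>)" using link_edge_iff[OF \<sigma> m] ab by simp
          have ne: "a \<noteq> b" using link_vertices_insert(3)[OF \<sigma> m(1) b] .
          show "a \<in> ?A \<and> b \<in> ?A \<and> a \<noteq> b \<and> M a b > 0"
            using m ne edge[OF m ne] edge_pos[OF m(1) b] by simp
        qed
      qed
      show "quad_form ?A M a \<le> (\<Sum>x\<in>?A. (\<Sum>y\<in>?A. M x y * a $ y)\<^sup>2 / D x)" for a
      proof -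
        have "quad_form ?A M a = polar \<sigma> ([a, a] @ w # us)"
          unfolding M_def quad_form_polar[OF \<sigma>] vs by simp
        \<comment> \<open>By symmetry \<open>w\<close> may be expanded first, so its positive
          entries weight the forms of the links, to each of which reversed Cauchy-Schwarz
          applies.\<close>
        also have "\<dots> = polar \<sigma> (w # a # a # us)" using polar_to_front[OF \<sigma>, of "[a, a]" w us] by simp
        also have "\<dots> = (\<Sum>x\<in>?A. w $ x * Q x a a)" by (simp add: polar.simps(2)[of \<sigma> w] Q_def)
        also have "\<dots> \<le> (\<Sum>x\<in>?A. (\<Sum>y\<in>?A. M x y * a $ y)\<^sup>2 / D x)"
        proof (rule sum_mono)
          fix x assume x: "x \<in> ?A"
          have "Q x a a \<le> (Q x a w)\<^sup>2 / Q x w w"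
            using rcs[OF x, of a] Qpos[OF x] by (simp add: le_divide_eq mult.commute)
          then have "w $ x * Q x a a \<le> w $ x * ((Q x a w)\<^sup>2 / Q x w w)"
            using wpos[OF x] by (intro mult_left_mono) auto
          then show "w $ x * Q x a a \<le> (\<Sum>y\<in>?A. M x y * a $ y)\<^sup>2 / D x"
            unfolding Mrow[OF x] D_def by (simp add: mult.commute)
        qed
        finally show ?thesis .
      qed
    qed
    then show ?thesis unfolding M_def quad_form_polar[OF \<sigma>] .
  qed
  then show ?case by blast
qed

theorem link_poly_lorentzian:
  assumes \<sigma>: "\<sigma> \<in> X"
  shows "lorentzian (link_verts \<sigma>) (LC \<sigma>) (d - card \<sigma>) (link_poly d V S X \<mu> B W \<sigma>)"
proof -
  let ?k = "d - card \<sigma>"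
  have k: "card \<sigma> + ?k = d" using card_face_le[OF \<sigma>] by simp
  have P: "foldr dir_deriv vs (link_poly d V S X \<mu> B W \<sigma>) t = polar \<sigma> vs" if "length vs = ?k" for vs t
    using foldr_dir_deriv[OF \<sigma>, of vs 0 t] that by (simp add: link_poly_def)
  show ?thesis
    unfolding lorentzian_def homogeneous_poly_def
  proof (intro conjI allI impI ballI)
    show "open_convex_cone (link_verts \<sigma>) (LC \<sigma>)" by (rule open_convex_link_cone[OF \<sigma>])
    show "real_polynomial_function (link_poly d V S X \<mu> B W \<sigma>)"
      unfolding link_poly_def by (rule real_polynomial_link_poly)
    show "link_poly d V S X \<mu> B W \<sigma> (c *\<^sub>R t) = c ^ ?k * link_poly d V S X \<mu> B W \<sigma> t" for c t
      unfolding link_poly_def by (rule link_poly_homogeneous)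
    show "foldr dir_deriv vs (link_poly d V S X \<mu> B W \<sigma>) t > 0" if "length vs = ?k \<and> set vs \<subseteq> LC \<sigma>" for vs t
      using that P polar_pos[OF \<sigma>] k by simp
    fix vs t
    assume k2: "2 \<le> ?k" and vs: "length vs = ?k - 2 \<and> set vs \<subseteq> LC \<sigma>"
    \<comment> \<open>A Hessian entry is two further derivatives along coordinate vectors. All
      \<open>?k\<close> arguments are then used up, so the Hessian is constant in
      \<open>t\<close>.\<close>
    have H: "hessian (foldr dir_deriv vs (link_poly d V S X \<mu> B W \<sigma>)) t = (\<lambda>x y. polar \<sigma> (axis x 1 # axis y 1 # vs))"
    proof (intro ext)
      fix x y
      show "hessian (foldr dir_deriv vs (link_poly d V S X \<mu> B W \<sigma>)) t x y = polar \<sigma> (axis x 1 # axis y 1 # vs)"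
        using P[of "axis x 1 # axis y 1 # vs" t] vs k2 by (simp add: hessian_def)
    qed
    obtain c where c: "\<And>a. c \<bullet> a = 0 \<Longrightarrow> polar \<sigma> (a # a # vs) \<le> 0"
    proof -
      have "card \<sigma> + (length vs + 2) = d" using vs k k2 by linarith
      then show ?thesis using hyperplane[OF \<sigma>, of vs] vs that by blast
    qed
    show "size {#l \<in># spectrum_on (link_verts \<sigma>) (hessian (foldr dir_deriv vs (link_poly d V S X \<mu> B W \<sigma>)) t). l > 0#} \<le> 1"
      unfolding H
    proof (rule one_positive_eigenvalue)
      show "quad_form (link_verts \<sigma>) (\<lambda>x y. polar \<sigma> (axis x 1 # axis y 1 # vs)) a \<le> 0" if "c \<bullet> a = 0" for a
        using c[OF that] quad_form_polar[OF \<sigma>] by simp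
    qed (rule polar_swap[OF \<sigma>])
  qed
qed

end

theorem theorem4p10:
  fixes d :: nat and V B :: "'v set" and S :: "'v \<Rightarrow> ('x::finite) set"
    and X :: "'x set set" and \<mu> :: "'x set \<Rightarrow> real" and W :: "'v \<Rightarrow> 'v \<Rightarrow> real"
  assumes "partite_complex d V S X \<mu>"
    and "connected_complex d X"
    and "absorbing_walk V B W"
    and "\<And>\<sigma> u v. \<lbrakk>\<sigma> \<in> X; card \<sigma> + 2 = d; u \<noteq> v; V - sites V S \<sigma> = {u, v}\<rbrakk> \<Longrightarrow>
           lambda2 (link_vertices X \<sigma>) (walk_matrix X \<mu> \<sigma>) \<le> sqrt (W u v * W v u)"
  shows "\<forall>\<sigma>\<in>X. lorentzian (link_vertices X \<sigma>) (link_cone V S X B W \<sigma>) (d - card \<sigma>)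
                  (link_poly d V S X \<mu> B W \<sigma>)"
proof -
  interpret spectral_complex V B W d S X \<mu>
    using assms by unfold_locales
  show ?thesis using link_poly_lorentzian by blast
qed

end
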